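(* Let $H=\sum_{Z\subseteq\Lambda,\ |Z|\le k}h_Z$ be a $k$-local Hamiltonian on a $D$-dimensional spin lattice $\Lambda$ satisfying the power-law decay assumption with exponent $\alpha>D$ (see context). Let $t>0$ and let $\Delta t$ be an arbitrary positive constant smaller than $1/(2e\tilde g)$ with $t/\Delta t\in\mathbb{N}$. Let $R$ be a positive integer that is a multiple of $t/\Delta t$. Then for every site $i\in\Lambda$ and every operator $W_i$ supported on $\{i\}$ with $\|W_i\|=1$, with $W_i(t)=e^{iHt}W_ie^{-iHt}$, there exists an operator $\tilde W^{(t)}_{i[R]}$ supported on the ball $i[R]$ such that $$\left\|W_i(t)-\tilde W^{(t)}_{i[R]}\right\|_F\le 2^{D-1}C_0\,(\Delta t)^{-\alpha+\frac{D+1}{2}}\,t^{\alpha-\frac{D-1}{2}}\,R^{-\alpha+D},$$ where $$C_0=\frac{2^{\alpha-D/2+2}J_0\gamma}{2\alpha-D-1}+\frac{80\,\tilde g\,\gamma\,2^{(3\alpha-D)/2}}{\alpha-D}\sqrt{2\alpha-2D+\gamma}.$$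
   Context: Lattice: $\Lambda$ is the finite vertex set ($|\Lambda|=n$) of a connected $D$-dimensional graph ($D\ge1$ an integer); each vertex carries a spin-$1/2$, so the Hilbert space is $(\mathbb{C}^2)^{\otimes n}$. $d_{i,i'}$ is the graph distance; $i[r]=\{i'\in\Lambda: d_{i,i'}\le r\}$. $\gamma\ge1$ is a geometric constant (independent of $n$) with $|i[r]|\le\gamma r^D$ and $|\{i'\in\Lambda:d_{i,i'}=r\}|\le\gamma r^{D-1}$ for all $i\in\Lambda$ and integers $r\ge1$ (the latter set is identified with the surface $\partial(i[r])$ of the ball). Hamiltonian: $H=\sum_{|Z|\le k}h_Z$, with $h_Z$ Hermitian and acting on the spins in $Z$. Each $h_Z$ is expanded as $h_Z=\sum_{q=1}^{3^{|Z|}}J_{Z,q}\mathrm{P}_{Z,q}$, where $\mathrm{P}_{Z,q}$, $q=1,\dots,3^{|Z|}$, are the products over the sites of $Z$ of one of $\sigma^x,\sigma^y,\sigma^z$ at each site of $Z$. Power-law decay assumption: $\alpha>D$ and for all $r$, $\sup_{i,i'\in\Lambda:\,d_{i,i'}=r}\ \sum_{Z\supset\{i,i'\}}\|h_Z\|\le J_0(r+1)^{-\alpha}$, where $J_0$ is a constant independent of $n$ and $\|\cdot\|$ is the operator norm. Constants: $J:=3^{k/2}J_0$; $g$ is a constant, independent of $n$, with $\max_{i\in\Lambda}\sum_{(Z,q):Z\ni i}|J_{Z,q}|\le g$ (one may take $g=\frac{\alpha-D+1}{\alpha-D}J\gamma$); $\lambda$ is a constant, independent of $n$, with $\sum_{i_0\in\Lambda}(d_{i,i_0}+1)^{-\alpha}(d_{i_0,i'}+1)^{-\alpha}\le\lambda(d_{i,i'}+1)^{-\alpha}$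 for all $i,i'\in\Lambda$; $\tilde g:=\max(gk,\lambda J)$. Normalized Frobenius norm: $\|O\|_F:=\sqrt{\mathrm{tr}(O^\dagger O)/\mathrm{tr}(\hat 1)}$. *)

theory Defs
  imports "HOL-Analysis.Analysis"
begin

definition adjoint_mat :: "complex^'n^'m \<Rightarrow> complex^'m^'n" where
  "adjoint_mat A = map_matrix cnj (transpose A)"

definition hermitian_mat :: "complex^'n^'n \<Rightarrow> bool" where
  "hermitian_mat A \<longleftrightarrow> adjoint_mat A = A"

definition cscale_mat :: "complex \<Rightarrow> complex^'n^'m \<Rightarrow> complex^'n^'m" where
  "cscale_mat c A = map_matrix ((*) c) A"

definition pow_mat :: "complex^'n^'n \<Rightarrow> nat \<Rightarrow> complex^'n^'n" where
  "pow_mat A n = (((**) A) ^^ n) (mat 1)"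

definition exp_mat :: "complex^'n^'n \<Rightarrow> complex^'n^'n" where
  "exp_mat A = (\<Sum>n. (1 / fact n) *\<^sub>R pow_mat A n)"

definition op_norm :: "complex^'n^'n \<Rightarrow> real" where
  "op_norm A = onorm (\<lambda>x. A *v x)"

definition frob_norm :: "complex^'n^'n \<Rightarrow> real" where
  "frob_norm A =
     sqrt (Re (trace (adjoint_mat A ** A) / trace (mat 1 :: complex^'n^'n)))"

lemma pow_mat_entry_bound:
  fixes A :: "complex^'n^'n"
  assumes M: "\<And>i j. norm (A $ i $ j) \<le> M"
  shows "norm (pow_mat A n $ i $ j) \<le> (real CARD('n) * M) ^ n"
proof (induction n arbitrary: i j)
  case 0
  show ?case by (simp add: pow_mat_def mat_def)
next
  case (Suc n)
  have M0: "0 \<le> M" using M[of i j] norm_ge_zero order_trans by blast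
  have "norm (pow_mat A (Suc n) $ i $ j) = norm (\<Sum>l\<in>UNIV. A $ i $ l * pow_mat A n $ l $ j)"
    by (simp add: pow_mat_def matrix_matrix_mult_def)
  also have "\<dots> \<le> (\<Sum>l\<in>(UNIV::'n set). M * (real CARD('n) * M) ^ n)"
    by (rule sum_norm_le) (simp add: norm_mult mult_mono M Suc.IH M0)
  finally show ?case by (simp add: mult_ac)
qed

lemma summable_exp_mat:
  fixes A :: "complex^'n^'n"
  shows "summable (\<lambda>n. (1 / fact n) *\<^sub>R pow_mat A n)"
proof -
  define M where "M = norm A"
  have M: "norm (A $ i $ j) \<le> M" for i j
    unfolding M_def by (meson Finite_Cartesian_Product.norm_nth_le order_trans)
  define c where "c = real CARD('n) * M"
  have bd: "norm (pow_mat A n) \<le> real CARD('n) * (real CARD('n) * c ^ n)" for n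
  proof -
    have "norm (pow_mat A n $ i) \<le> real CARD('n) * c ^ n" for i
    proof -
      have "norm (pow_mat A n $ i) \<le> (\<Sum>j\<in>UNIV. norm (pow_mat A n $ i $ j))"
        unfolding norm_vec_def[of "pow_mat A n $ i"] by (rule L2_set_le_sum) simp
      also have "\<dots> \<le> (\<Sum>j\<in>(UNIV::'n set). c ^ n)"
        by (rule sum_mono) (use pow_mat_entry_bound[of A M] M in \<open>simp add: c_def\<close>)
      finally show ?thesis by simp
    qed
    then have "(\<Sum>i\<in>UNIV. norm (pow_mat A n $ i)) \<le> (\<Sum>i\<in>(UNIV::'n set). real CARD('n) * c ^ n)"
      by (intro sum_mono) auto
    moreover have "norm (pow_mat A n) \<le> (\<Sum>i\<in>UNIV. norm (pow_mat A n $ i))"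
      unfolding norm_vec_def[of "pow_mat A n"] by (rule L2_set_le_sum) simp
    ultimately show ?thesis by simp
  qed
  have "summable (\<lambda>n. (real CARD('n) * real CARD('n)) * (inverse (fact n) * c ^ n))"
    by (intro summable_mult summable_exp)
  then show ?thesis
  proof (rule summable_comparison_test')
    fix n :: nat
    assume "0 \<le> n"
    show "norm ((1 / fact n) *\<^sub>R pow_mat A n)
      \<le> (real CARD('n) * real CARD('n)) * (inverse (fact n) * c ^ n)"
      using mult_left_mono[OF bd[of n], of "inverse (fact n)"] by (simp add: field_simps)
  qed
qed

definition connected_graph :: "('v \<times> 'v) set \<Rightarrow> bool" where
  "connected_graph E \<longleftrightarrow> sym E \<and> irrefl E \<and> (\<forall>i j. (i, j) \<in> E\<^sup>*)"

definition gdist :: "('v \<times> 'v) set \<Rightarrow> 'v \<Rightarrow> 'v \<Rightarrow> nat" where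
  "gdist E i j = (LEAST n. (i, j) \<in> E ^^ n)"

definition gball :: "('v \<times> 'v) set \<Rightarrow> 'v \<Rightarrow> nat \<Rightarrow> 'v set" where
  "gball E i r = {j. gdist E i j \<le> r}"

definition gsphere :: "('v \<times> 'v) set \<Rightarrow> 'v \<Rightarrow> nat \<Rightarrow> 'v set" where
  "gsphere E i r = {j. gdist E i j = r}"

text \<open>
  The vertex set is the finite type \<open>'v\<close>. The standard basis of the tensor product of one copy
  of \<open>complex^2\<close> per vertex is indexed by the configurations \<open>'v \<Rightarrow> 2\<close>.
\<close>

type_synonym 'v spin_op = "complex^('v \<Rightarrow> 2)^('v \<Rightarrow> 2)"

text \<open>
  \<open>A\<close> is of the form \<open>B \<otimes> 1\<close>, where \<open>B\<close> acts on the spins in \<open>X\<close>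
  and \<open>1\<close> is the identity on the remaining spins.
\<close>

definition supported_on :: "'v::finite set \<Rightarrow> 'v spin_op \<Rightarrow> bool" where
  "supported_on X A \<longleftrightarrow>
     (\<exists>B :: ('v \<Rightarrow> 2) \<Rightarrow> ('v \<Rightarrow> 2) \<Rightarrow> complex. \<forall>s s'.
        A $ s $ s' = (if \<forall>v\<in>-X. s v = s' v then B (restrict s X) (restrict s' X) else 0))"

datatype pauli = PX | PY | PZ

fun pauli_mat :: "pauli \<Rightarrow> complex^2^2" where
  "pauli_mat PX = vector [vector [0, 1], vector [1, 0]]"
| "pauli_mat PY = vector [vector [0, - \<i>], vector [\<i>, 0]]"
| "pauli_mat PZ = vector [vector [1, 0], vector [0, - 1]]"

definition pauli_labels :: "'v set \<Rightarrow> ('v \<Rightarrow> pauli) set" where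
  "pauli_labels Z = (Z \<rightarrow>\<^sub>E UNIV)"

definition pauli_string :: "'v::finite set \<Rightarrow> ('v \<Rightarrow> pauli) \<Rightarrow> 'v spin_op" where
  "pauli_string Z q =
     (\<chi> s s'. \<Prod>v\<in>UNIV. (if v \<in> Z then pauli_mat (q v) else mat 1) $ s v $ s' v)"

definition hamiltonian :: "nat \<Rightarrow> ('v::finite set \<Rightarrow> 'v spin_op) \<Rightarrow> 'v spin_op" where
  "hamiltonian k h = (\<Sum>Z | card Z \<le> k. h Z)"

definition evolve :: "'v::finite spin_op \<Rightarrow> real \<Rightarrow> 'v spin_op \<Rightarrow> 'v spin_op" where
  "evolve H t W =
     exp_mat (cscale_mat (\<i> * of_real t) H) ** W ** exp_mat (cscale_mat (- \<i> * of_real t) H)"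

definition J_const :: "nat \<Rightarrow> real \<Rightarrow> real" where
  "J_const k J0 = 3 powr (real k / 2) * J0"

definition g_tilde :: "nat \<Rightarrow> real \<Rightarrow> real \<Rightarrow> real \<Rightarrow> real" where
  "g_tilde k g lam J0 = max (g * real k) (lam * J_const k J0)"

definition C0_const :: "nat \<Rightarrow> real \<Rightarrow> real \<Rightarrow> real \<Rightarrow> real \<Rightarrow> real" where
  "C0_const D \<alpha> \<gamma> J0 gt =
     2 powr (\<alpha> - real D / 2 + 2) * J0 * \<gamma> / (2 * \<alpha> - real D - 1)
     + 80 * gt * \<gamma> * 2 powr ((3 * \<alpha> - real D) / 2) / (\<alpha> - real D)
       * sqrt (2 * \<alpha> - 2 * real D + \<gamma>)"

end

theory Submission
  imports Defs
begin

text \<open>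
  Put \<open>m = t / dt\<close>, \<open>R = m l\<close>, and evolve in \<open>m\<close> steps, using in step \<open>j\<close> only the interaction terms
  inside \<open>Y = i[j l]\<close>; this keeps the operator supported on \<open>Y\<close>. By Duhamel's formula one step costs
  at most \<open>dt\<close> times the supremum over \<open>s \<le> dt\<close> of the Frobenius norm of \<open>[V(-s), B]\<close>, where \<open>V\<close> is the
  sum of the terms not contained in \<open>Y\<close>, evolved inside \<open>Y\<close>, and \<open>\<parallel>B\<parallel> \<le> 1\<close> with \<open>B\<close> supported on
  the previous ball \<open>X\<close>. Only Pauli words touching \<open>X\<close> contribute, and since the evolution inside \<open>Y\<close>
  never acts outside \<open>Y\<close>, each such word also contains a site outside \<open>Y\<close>. Orthogonality of the
  Pauli words therefore bounds the squared norm by the sum over \<open>x \<in> X\<close> and \<open>y \<notin> Y\<close> of the squared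
  total weight of the words containing both \<open>x\<close> and \<open>y\<close>, and a short-time commutator expansion shows
  that this weight is at most a constant times \<open>J (d(x, y) + 1)\<close> to the power \<open>-\<alpha>\<close>. Counting pairs
  by distance and summing over the steps gives the bound.
\<close>

text \<open>Orthogonality makes Pauli words add up in the square. Summing squared weights over pairs
  across a shell gives about \<open>(m * l) ^ (D - 1) * l powr (D + 1 - 2 * \<alpha>)\<close>; the
  square root is \<open>m powr ((D - 1) / 2) * l powr (D - \<alpha>)\<close>, and \<open>m\<close>
  steps of length \<open>dt\<close> turn it into the stated powers of \<open>dt\<close>,
  \<open>t\<close> and \<open>R\<close>. Adding the weights themselves, as for the operator norm,
  would converge only for \<open>\<alpha> > D + 1\<close>. The obstacle is that after some steps the
  observable \<open>B\<close> has no controlled Pauli expansion. So only its support and operator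
  norm are used, and in Duhamel's formula the local evolution is moved from \<open>B\<close> to
  \<open>V\<close>, at the price of a reversed time. Words grow under commutators: after
  \<open>n\<close> of them they have up to \<open>k * Suc n\<close> sites, and the weight grows like
  \<open>(2 * gt) ^ n * fact (Suc n)\<close>. The \<open>1 / fact n\<close> of Taylor's formula
  leaves \<open>Suc n * (2 * gt * s) ^ n\<close>, which forces short steps. For
  \<open>2 * gt * s \<le> 1 / 2\<close> the series is at most 4; with the factor 2 of a commutator
  this is the constant 8, to be compared with the 80 in \<open>C0_const\<close>.\<close>

section \<open>Matrix norms\<close>

text \<open>Through the interpretation below, this supplies the product rule for derivatives and the
  rules for finite sums and convergent series.\<close>

lemma matrix_mult_bounded_bilinear:
  "bounded_bilinear ((**) :: complex^'n^'n \<Rightarrow> complex^'n^'n \<Rightarrow> complex^'n^'n)"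
proof -
  have "bilinear ((**) :: complex^'n^'n \<Rightarrow> complex^'n^'n \<Rightarrow> complex^'n^'n)"
    unfolding bilinear_def
    by (auto intro!: linearI simp: vec_eq_iff matrix_matrix_mult_def algebra_simps sum.distrib
        scaleR_sum_right)
  then show ?thesis by (simp add: bilinear_conv_bounded_bilinear)
qed

interpretation mm: bounded_bilinear
  "(**) :: complex^'n^'n \<Rightarrow> complex^'n^'n \<Rightarrow> complex^'n^'n"
  by (rule matrix_mult_bounded_bilinear)

definition commutator :: "complex^'n^'n \<Rightarrow> complex^'n^'n \<Rightarrow> complex^'n^'n" where
  "commutator A B = A ** B - B ** A"

lemma commutator_bounded_bilinear:
  "bounded_bilinear (commutator :: complex^'n^'n \<Rightarrow> complex^'n^'n \<Rightarrow> complex^'n^'n)"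
  unfolding bilinear_conv_bounded_bilinear[symmetric] bilinear_def commutator_def
  by (auto intro!: linearI simp: mm.add_left mm.add_right mm.scaleR_left mm.scaleR_right algebra_simps)

interpretation cm: bounded_bilinear
  "commutator :: complex^'n^'n \<Rightarrow> complex^'n^'n \<Rightarrow> complex^'n^'n"
  by (rule commutator_bounded_bilinear)

lemma adjoint_mat_nth [simp]: "adjoint_mat A $ a $ b = cnj (A $ b $ a)"
  by (simp add: adjoint_mat_def transpose_def)

lemma cscale_mat_nth [simp]: "cscale_mat c A $ a $ b = c * A $ a $ b"
  by (simp add: cscale_mat_def)

lemma adjoint_mat_mult: "adjoint_mat (A ** B) = adjoint_mat B ** adjoint_mat A"
  by (simp add: vec_eq_iff matrix_matrix_mult_def mult.commute)

lemma cscale_mat_mult_left: "cscale_mat c A ** B = cscale_mat c (A ** B)"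
  and cscale_mat_mult_right: "A ** cscale_mat c B = cscale_mat c (A ** B)"
  by (simp_all add: vec_eq_iff matrix_matrix_mult_def sum_distrib_left mult_ac)

lemma commutator_cscale_left: "commutator (cscale_mat c A) B = cscale_mat c (commutator A B)"
  by (simp add: commutator_def cscale_mat_mult_left cscale_mat_mult_right vec_eq_iff algebra_simps)

text \<open>The library norm on matrices is the unnormalised Hilbert-Schmidt norm;
  \<open>frob_norm\<close> differs from it by a dimension factor, so the Frobenius estimates are
  carried out with \<open>norm\<close>.\<close>

lemma norm_mat_sq: "(norm (A :: complex^'n^'m))\<^sup>2 = (\<Sum>a\<in>UNIV. \<Sum>b\<in>UNIV. (cmod (A $ a $ b))\<^sup>2)"
  by (simp add: norm_vec_def L2_set_def sum_nonneg)

lemma norm_adjoint_mat [simp]: "norm (adjoint_mat A) = norm A"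
proof -
  have "(norm (adjoint_mat A))\<^sup>2 = (norm A)\<^sup>2"
    unfolding norm_mat_sq by (subst sum.swap) simp
  then show ?thesis by simp
qed

lemma trace_adjoint_mult:
  "trace (adjoint_mat A ** A) = of_real ((norm (A::complex^'n^'n))\<^sup>2)"
proof -
  have "trace (adjoint_mat A ** A) = (\<Sum>a\<in>UNIV. \<Sum>b\<in>UNIV. of_real ((cmod (A $ b $ a))\<^sup>2))"
    unfolding complex_norm_square by (simp add: trace_def matrix_matrix_mult_def mult.commute)
  also have "\<dots> = of_real (\<Sum>b\<in>UNIV. \<Sum>a\<in>UNIV. (cmod (A $ b $ a))\<^sup>2)"
    by (subst sum.swap) simp
  finally show ?thesis by (simp add: norm_mat_sq)
qed

lemma frob_norm_eq: "frob_norm (A::complex^'n^'n) = norm A / sqrt (real CARD('n))"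
proof -
  have "trace (mat 1 :: complex^'n^'n) = complex_of_real (real CARD('n))"
    by (simp add: trace_def mat_def)
  then have "Re (trace (adjoint_mat A ** A) / trace (mat 1 :: complex^'n^'n)) = (norm A)\<^sup>2 / real CARD('n)"
    by (simp only: trace_adjoint_mult of_real_divide[symmetric] Re_complex_of_real)
  then show ?thesis by (simp add: frob_norm_def real_sqrt_divide)
qed

lemma op_norm: "norm (A *v x) \<le> op_norm A * norm (x :: complex^'n)"
  unfolding op_norm_def by (rule onorm) simp

lemma op_norm_leI:
  assumes "\<And>x. norm (A *v x) \<le> c * norm (x :: complex^'n)"
  shows "op_norm A \<le> c"
  unfolding op_norm_def using assms by (rule onorm_le)

lemma op_norm_nonneg [simp]: "0 \<le> op_norm A"
  unfolding op_norm_def by (rule onorm_pos_le) simp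

lemma norm_mat_sq_columns:
  "(norm (A :: complex^'n^'n))\<^sup>2 = (\<Sum>b\<in>UNIV. (norm (column b A))\<^sup>2)"
  unfolding norm_mat_sq
  by (subst sum.swap) (simp add: norm_vec_def L2_set_def sum_nonneg column_def)

text \<open>\<open>A\<close> acts on each column of \<open>B\<close> separately, and squared norms
  add up over columns.\<close>

lemma norm_mult_le_op_norm_left: "norm (A ** B) \<le> op_norm A * norm (B :: complex^'n^'n)"
proof -
  have col: "column b (A ** B) = A *v column b B" for b
    by (simp add: vec_eq_iff column_def matrix_matrix_mult_def matrix_vector_mult_def)
  have "(norm (A ** B))\<^sup>2 = (\<Sum>b\<in>UNIV. (norm (A *v column b B))\<^sup>2)"
    by (simp only: norm_mat_sq_columns col)
  also have "\<dots> \<le> (\<Sum>b\<in>UNIV. (op_norm A * norm (column b B))\<^sup>2)"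
    by (intro sum_mono power_mono op_norm) auto
  also have "\<dots> = (op_norm A * norm B)\<^sup>2"
    by (simp add: power_mult_distrib norm_mat_sq_columns[of B] sum_distrib_left)
  finally show ?thesis by (rule power2_le_imp_le) simp
qed

text \<open>\<open>inner\<close> on complex vectors is the real part of the Hermitian form, which
  suffices for norms and for Cauchy-Schwarz.\<close>

lemma inner_adjoint_mat:
  fixes x y :: "complex^'n"
  shows "inner (adjoint_mat A *v x) y = inner x (A *v y)"
proof -
  have *: "inner u w = Re (\<Sum>a\<in>UNIV. cnj (u $ a) * w $ a)" for u w :: "complex^'n"
    by (simp add: inner_vec_def inner_complex_def)
  have "inner (adjoint_mat A *v x) y = Re (\<Sum>a\<in>UNIV. \<Sum>b\<in>UNIV. A $ b $ a * cnj (x $ b) * y $ a)"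
    unfolding * by (simp add: matrix_vector_mult_def sum_distrib_right del: Re_sum)
  also have "\<dots> = inner x (A *v y)"
    unfolding * by (subst sum.swap)
      (simp add: matrix_vector_mult_def sum_distrib_left mult.commute mult.left_commute del: Re_sum)
  finally show ?thesis .
qed

lemma op_norm_adjoint_le: "op_norm (adjoint_mat A) \<le> op_norm (A :: complex^'n^'n)"
proof (rule op_norm_leI)
  fix x :: "complex^'n"
  let ?y = "adjoint_mat A *v x"
  have "(norm ?y)\<^sup>2 = inner x (A *v ?y)"
    by (simp only: power2_norm_eq_inner inner_adjoint_mat)
  also have "\<dots> \<le> norm x * norm (A *v ?y)" by (rule norm_cauchy_schwarz)
  also have "\<dots> \<le> norm x * (op_norm A * norm ?y)"
    by (intro mult_left_mono op_norm) simp
  finally have "norm ?y * norm ?y \<le> (op_norm A * norm x) * norm ?y"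
    by (simp add: power2_eq_square mult_ac)
  then show "norm ?y \<le> op_norm A * norm x"
    by (cases "norm ?y = 0") (auto simp: mult_le_cancel_right)
qed

lemma norm_mult_le_op_norm_right:
  fixes A B :: "complex^'n^'n"
  shows "norm (A ** B) \<le> norm A * op_norm B"
proof -
  have "norm (A ** B) = norm (adjoint_mat B ** adjoint_mat A)"
    by (metis adjoint_mat_mult norm_adjoint_mat)
  also have "\<dots> \<le> op_norm (adjoint_mat B) * norm (adjoint_mat A)"
    by (rule norm_mult_le_op_norm_left)
  also have "\<dots> \<le> op_norm B * norm A"
    by (simp add: mult_right_mono op_norm_adjoint_le)
  finally show ?thesis by (simp add: mult.commute)
qed

lemma norm_le_op_norm: "norm (A :: complex^'n^'n) \<le> sqrt (real CARD('n)) * op_norm A"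
proof -
  have "norm (A ** mat 1) \<le> op_norm A * norm (mat 1 :: complex^'n^'n)"
    by (rule norm_mult_le_op_norm_left)
  moreover have "(norm (mat 1 :: complex^'n^'n))\<^sup>2 = real CARD('n)"
    unfolding norm_mat_sq mat_def
    by (simp add: if_distrib[of cmod] if_distrib[of "\<lambda>x. x\<^sup>2"] cong: if_cong)
  then have "norm (mat 1 :: complex^'n^'n) = sqrt (real CARD('n))"
    by (simp add: real_sqrt_unique)
  ultimately show ?thesis by (simp add: mult.commute)
qed

text \<open>The two norms are mixed on purpose: the Hilbert-Schmidt norm for a Pauli sum, where
  orthogonality helps, and the operator norm for the observable, of which only an operator norm
  bound is known.\<close>

lemma norm_commutator_le: "norm (commutator A B) \<le> 2 * norm A * op_norm B"
proof -
  have "norm (commutator A B) \<le> norm (A ** B) + norm (B ** A)"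
    unfolding commutator_def by (rule norm_triangle_ineq4)
  also have "\<dots> \<le> norm A * op_norm B + op_norm B * norm A"
    by (intro add_mono norm_mult_le_op_norm_right norm_mult_le_op_norm_left)
  finally show ?thesis by (simp add: mult_ac)
qed

lemma op_norm_mult_le: "op_norm (A ** B) \<le> op_norm A * op_norm B"
proof (rule op_norm_leI)
  fix x
  have "norm ((A ** B) *v x) \<le> op_norm A * norm (B *v x)"
    by (simp add: op_norm flip: matrix_vector_mul_assoc)
  also have "\<dots> \<le> op_norm A * (op_norm B * norm x)"
    by (intro mult_left_mono op_norm) simp
  finally show "norm ((A ** B) *v x) \<le> op_norm A * op_norm B * norm x"
    by (simp add: mult_ac)
qed

definition unitary_mat :: "complex^'n^'n \<Rightarrow> bool" where
  "unitary_mat U \<longleftrightarrow> adjoint_mat U ** U = mat 1"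

lemma op_norm_unitary_le:
  fixes U :: "complex^'n^'n"
  assumes U: "unitary_mat U"
  shows "op_norm U \<le> 1"
proof (rule op_norm_leI)
  fix x :: "complex^'n"
  have "(norm (U *v x))\<^sup>2 = inner (adjoint_mat U *v (U *v x)) x"
    by (simp add: power2_norm_eq_inner inner_adjoint_mat)
  also have "\<dots> = (norm x)\<^sup>2"
    using U by (simp add: matrix_vector_mul_assoc unitary_mat_def power2_norm_eq_inner)
  finally show "norm (U *v x) \<le> 1 * norm x" by simp
qed

section \<open>Unitary evolution\<close>

text \<open>Evolution under the generator \<open>A\<close>, which is \<open>\<i> H\<close> for a Hamiltonian \<open>H\<close>.\<close>

definition propagator :: "complex^'n^'n \<Rightarrow> real \<Rightarrow> complex^'n^'n" where
  "propagator A t = exp_mat (t *\<^sub>R A)"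

lemma pow_mat_0 [simp]: "pow_mat A 0 = mat 1"
  and pow_mat_Suc: "pow_mat A (Suc n) = A ** pow_mat A n"
  by (simp_all add: pow_mat_def)

lemma pow_mat_commute: "pow_mat A n ** A = A ** pow_mat A n"
  by (induction n) (simp_all add: pow_mat_Suc flip: matrix_mul_assoc)

lemma pow_mat_scaleR: "pow_mat (c *\<^sub>R A) n = c ^ n *\<^sub>R pow_mat A n"
  by (induction n) (simp_all add: pow_mat_Suc mm.scaleR_left mm.scaleR_right)

lemma pow_mat_cscale: "pow_mat (cscale_mat c A) n = cscale_mat (c ^ n) (pow_mat A n)"
proof (induction n)
  case (Suc n)
  show ?case
    unfolding pow_mat_Suc Suc cscale_mat_mult_left cscale_mat_mult_right
    by (simp add: vec_eq_iff)
qed (simp add: vec_eq_iff)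

lemma exp_mat_nth:
  "(\<lambda>n. pow_mat A n $ a $ b / fact n) sums (exp_mat A $ a $ b)"
proof -
  have "(\<lambda>n. (1 / fact n) *\<^sub>R pow_mat A n) sums exp_mat A"
    unfolding exp_mat_def using summable_exp_mat by (rule summable_sums)
  from bounded_linear.sums[OF bounded_linear_vec_nth bounded_linear.sums[OF bounded_linear_vec_nth this]]
  show ?thesis by (simp add: scaleR_conv_of_real[where 'a = complex] field_simps)
qed

text \<open>A matrix is a finite sum of images of its entries under the bounded linear maps
  \<open>e a b\<close>. This reduces the derivative of the exponential to scalar power
  series.\<close>

lemma has_vector_derivative_matI:
  assumes "\<And>a b. ((\<lambda>t. f t $ a $ b) has_vector_derivative D $ a $ b) F"
  shows "(f has_vector_derivative (D :: complex^'n^'m)) F"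
proof -
  define e :: "'m \<Rightarrow> 'n \<Rightarrow> complex \<Rightarrow> complex^'n^'m"
    where "e a b z = (\<chi> i j. if i = a \<and> j = b then z else 0)" for a b z
  have split: "(\<Sum>a\<in>UNIV. \<Sum>b\<in>UNIV. e a b (M $ a $ b)) = M" for M
  proof -
    have "(\<Sum>a\<in>UNIV. \<Sum>b\<in>UNIV. if i = a \<and> j = b then M $ a $ b else 0) = M $ i $ j" for i j
    proof -
      have "(\<Sum>b\<in>UNIV. if i = a \<and> j = b then M $ a $ b else 0) = (if i = a then M $ a $ j else 0)" for a
        by (cases "i = a") simp_all
      then show ?thesis by simp
    qed
    then show ?thesis by (simp add: vec_eq_iff e_def)
  qed
  have "bounded_linear (e a b)" for a b
    unfolding linear_conv_bounded_linear[symmetric]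
    by (rule linearI) (simp_all add: e_def vec_eq_iff)
  then have "((\<lambda>t. e a b (f t $ a $ b)) has_vector_derivative e a b (D $ a $ b)) F" for a b
    by (rule bounded_linear.has_vector_derivative) (rule assms)
  then have "((\<lambda>t. \<Sum>a\<in>UNIV. \<Sum>b\<in>UNIV. e a b (f t $ a $ b)) has_vector_derivative
      (\<Sum>a\<in>UNIV. \<Sum>b\<in>UNIV. e a b (D $ a $ b))) F"
    by (intro has_vector_derivative_sum)
  then show ?thesis by (simp add: split)
qed

lemma propagator_0 [simp]: "propagator A 0 = mat 1"
proof -
  have "propagator A 0 $ a $ b = mat 1 $ a $ b" for a b
  proof (rule sums_unique2)
    show "(\<lambda>n. pow_mat (0 *\<^sub>R A) n $ a $ b / fact n) sums (propagator A 0 $ a $ b)"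
      unfolding propagator_def by (rule exp_mat_nth)
    show "(\<lambda>n. pow_mat (0 *\<^sub>R A) n $ a $ b / fact n) sums (mat 1 $ a $ b)"
    proof -
      have "pow_mat (0 *\<^sub>R A) n $ a $ b / fact n = (if n = 0 then mat 1 $ a $ b else 0)" for n
        unfolding pow_mat_scaleR by (cases n) simp_all
      then show ?thesis
        using sums_single[of 0 "\<lambda>n. mat 1 $ a $ b"] by (simp only:)
    qed
  qed
  then show ?thesis by (simp add: vec_eq_iff)
qed

text \<open>Each entry of \<open>exp_mat (cscale_mat z A)\<close> is an everywhere convergent
  complex power series in \<open>z\<close> and can be differentiated termwise; real \<open>z\<close>
  gives the propagator.\<close>

lemma propagator_deriv: "(propagator A has_vector_derivative A ** propagator A t) (at t)"
proof (rule has_vector_derivative_matI)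
  fix a b
  define c where "c n = pow_mat A n $ a $ b / fact n" for n
  have sm: "(\<lambda>n. c n * z ^ n) sums (exp_mat (cscale_mat z A) $ a $ b)" for z
    using exp_mat_nth[of "cscale_mat z A" a b] by (simp add: pow_mat_cscale c_def mult.commute)
  have rl: "exp_mat (cscale_mat (of_real x) A) = propagator A x" for x
    unfolding propagator_def by (rule arg_cong[of _ _ exp_mat]) (simp add: vec_eq_iff scaleR_conv_of_real[where 'a = complex])
  have eq: "(\<Sum>n. c n * z ^ n) = exp_mat (cscale_mat z A) $ a $ b" for z
    using sm by (rule sums_unique[symmetric])
  have d: "((\<lambda>z. exp_mat (cscale_mat z A) $ a $ b) has_field_derivative (\<Sum>n. diffs c n * z ^ n)) (at z)" for z
    using termdiffs_strong_converges_everywhere[of c z] sm unfolding eq by (auto simp: sums_iff)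
  have "(\<lambda>n. diffs c n * of_real t ^ n) sums ((A ** propagator A t) $ a $ b)"
  proof -
    have "(\<lambda>n. \<Sum>l\<in>UNIV. A $ a $ l * (pow_mat (t *\<^sub>R A) n $ l $ b / fact n)) sums
      (\<Sum>l\<in>UNIV. A $ a $ l * propagator A t $ l $ b)"
      unfolding propagator_def by (intro sums_sum sums_mult exp_mat_nth)
    also have "(\<lambda>n. \<Sum>l\<in>UNIV. A $ a $ l * (pow_mat (t *\<^sub>R A) n $ l $ b / fact n)) =
        (\<lambda>n. diffs c n * of_real t ^ n)"
      by (simp add: fun_eq_iff diffs_def c_def pow_mat_Suc pow_mat_scaleR matrix_matrix_mult_def
         sum_distrib_left sum_distrib_right sum_divide_distrib scaleR_conv_of_real[where 'a = complex] divide_simps mult_ac del: of_nat_Suc)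
    finally show ?thesis by (simp add: matrix_matrix_mult_def)
  qed
  then have "((\<lambda>z. exp_mat (cscale_mat z A) $ a $ b) has_field_derivative (A ** propagator A t) $ a $ b) (at (of_real t))"
    using d[of "of_real t"] by (simp add: sums_iff)
  from has_vector_derivative_real_field[OF this]
  show "((\<lambda>t. propagator A t $ a $ b) has_vector_derivative (A ** propagator A t) $ a $ b) (at t)"
    by (simp add: rl)
qed

lemma propagator_commute: "propagator A t ** A = A ** propagator A t"
proof -
  have sm: "(\<lambda>n. (1 / fact n) *\<^sub>R pow_mat (t *\<^sub>R A) n) sums propagator A t"
    unfolding propagator_def exp_mat_def using summable_exp_mat by (rule summable_sums)
  have comm: "pow_mat (t *\<^sub>R A) n ** A = A ** pow_mat (t *\<^sub>R A) n" for n
    by (simp add: pow_mat_scaleR mm.scaleR_left mm.scaleR_right pow_mat_commute)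
  show ?thesis
    using bounded_linear.sums[OF mm.bounded_linear_left[of A] sm]
      bounded_linear.sums[OF mm.bounded_linear_right[of A] sm]
    by (simp add: mm.scaleR_left mm.scaleR_right comm sums_iff)
qed

lemma propagator_neg_deriv:
  "((\<lambda>t. propagator A (- t)) has_vector_derivative - (A ** propagator A (- t))) (at t)"
proof -
  have "((propagator A \<circ> uminus) has_vector_derivative (- 1) *\<^sub>R (A ** propagator A (- t))) (at t)"
    by (rule vector_diff_chain_at) (auto intro!: derivative_eq_intros propagator_deriv)
  then show ?thesis by (simp add: o_def)
qed

lemma propagator_shift_deriv:
  "((\<lambda>s. propagator A (c + s)) has_vector_derivative A ** propagator A (c + s)) (at s)"
proof -
  have "((propagator A \<circ> (\<lambda>s. c + s)) has_vector_derivative 1 *\<^sub>R (A ** propagator A (c + s))) (at s)"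
    by (rule vector_diff_chain_at) (auto intro!: derivative_eq_intros propagator_deriv)
  then show ?thesis by (simp add: o_def)
qed

lemma has_vector_derivative_zero_constant:
  fixes f :: "real \<Rightarrow> 'a::real_normed_vector"
  assumes "\<And>x. (f has_vector_derivative 0) (at x)"
  shows "f x = f y"
  using has_derivative_zero_unique[OF convex_UNIV, of f y x] assms
  by (auto simp: has_vector_derivative_def)

text \<open>The product has derivative 0 in \<open>s\<close>, because \<open>A\<close> commutes with
  its propagator, and so keeps its value at \<open>s = 0\<close>. Inverses and the group law
  follow.\<close>

lemma propagator_add_minus: "propagator A (t + s) ** propagator A (- s) = propagator A t"
proof -
  have "((\<lambda>s. propagator A (t + s) ** propagator A (- s)) has_vector_derivative 0) (at s)" for s
    using mm.has_vector_derivative[OF propagator_shift_deriv[of A t s] propagator_neg_deriv[of A s]]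
    by (simp add: mm.minus_right matrix_mul_assoc propagator_commute)
  from has_vector_derivative_zero_constant[OF this, of s 0] show ?thesis by simp
qed

lemma propagator_inverse: "propagator A s ** propagator A (- s) = mat 1"
  using propagator_add_minus[of A 0 s] by simp

lemma propagator_inverse': "propagator A (- s) ** propagator A s = mat 1"
  using propagator_inverse[of A "- s"] by simp

lemma propagator_add: "propagator A (t + s) = propagator A t ** propagator A s"
proof -
  have "propagator A (t + s) = (propagator A (t + s) ** propagator A (- s)) ** propagator A s"
    by (simp add: propagator_inverse' flip: matrix_mul_assoc)
  then show ?thesis by (simp add: propagator_add_minus)
qed

lemma adjoint_pow_mat: "adjoint_mat (pow_mat A n) = pow_mat (adjoint_mat A) n"
proof (induction n)
  case 0
  show ?case by (auto simp: vec_eq_iff mat_def)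
next
  case (Suc n)
  show ?case
    by (simp add: pow_mat_Suc adjoint_mat_mult Suc pow_mat_commute)
qed

lemma adjoint_exp_mat: "adjoint_mat (exp_mat A) = exp_mat (adjoint_mat A)"
proof -
  have "adjoint_mat (exp_mat A) $ a $ b = exp_mat (adjoint_mat A) $ a $ b" for a b
  proof (rule sums_unique2)
    show "(\<lambda>n. pow_mat (adjoint_mat A) n $ a $ b / fact n) sums (exp_mat (adjoint_mat A) $ a $ b)"
      by (rule exp_mat_nth)
    show "(\<lambda>n. pow_mat (adjoint_mat A) n $ a $ b / fact n) sums (adjoint_mat (exp_mat A) $ a $ b)"
      using sums_cnj[THEN iffD2, OF exp_mat_nth[of A b a]] by (simp flip: adjoint_pow_mat)
  qed
  then show ?thesis by (simp add: vec_eq_iff)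
qed

section \<open>Heisenberg evolution of operators\<close>

definition antihermitian :: "complex^'n^'n \<Rightarrow> bool" where
  "antihermitian A \<longleftrightarrow> adjoint_mat A = - A"

lemma antihermitian_i_hermitian: "hermitian_mat H \<Longrightarrow> antihermitian (cscale_mat \<i> H)"
  by (auto simp: antihermitian_def hermitian_mat_def vec_eq_iff)

lemma unitary_propagator: "antihermitian A \<Longrightarrow> unitary_mat (propagator A t)"
proof -
  assume "antihermitian A"
  then have "adjoint_mat (t *\<^sub>R A) = (- t) *\<^sub>R A"
    by (auto simp: antihermitian_def vec_eq_iff scaleR_conv_of_real[where 'a = complex])
  then have "adjoint_mat (propagator A t) = propagator A (- t)"
    by (simp add: propagator_def adjoint_exp_mat)
  then show ?thesis by (simp add: unitary_mat_def propagator_inverse')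
qed

definition heis :: "complex^'n^'n \<Rightarrow> real \<Rightarrow> complex^'n^'n \<Rightarrow> complex^'n^'n" where
  "heis A t B = propagator A t ** B ** propagator A (- t)"

lemma evolve_eq_heis: "evolve H t B = heis (cscale_mat \<i> H) t B"
proof -
  have "cscale_mat (\<i> * of_real t) H = t *\<^sub>R cscale_mat \<i> H" for t
    by (simp add: vec_eq_iff scaleR_conv_of_real[where 'a = complex])
  from this[of t] this[of "- t"] show ?thesis
    by (simp add: evolve_def heis_def propagator_def)
qed

lemma bounded_linear_heis: "bounded_linear (heis A t)"
  unfolding heis_def
  by (intro bounded_linear_compose[OF mm.bounded_linear_left] mm.bounded_linear_right)

lemmas heis_diff = linear_diff[OF bounded_linear.linear[OF bounded_linear_heis]]

lemma heis_0 [simp]: "heis A 0 B = B"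
  by (simp add: heis_def)

lemma heis_add: "heis A (t + s) B = heis A t (heis A s B)"
proof -
  have "propagator A (- (t + s)) = propagator A (- s) ** propagator A (- t)"
    by (simp only: minus_add propagator_add)
  then show ?thesis
    by (simp add: heis_def propagator_add matrix_mul_assoc del: minus_add_distrib)
qed

lemma heis_mult: "heis A t B ** heis A t C = heis A t (B ** C)"
proof -
  have "heis A t B ** heis A t C = propagator A t ** B ** (propagator A (- t) ** propagator A t) ** C ** propagator A (- t)"
    by (simp add: heis_def matrix_mul_assoc)
  then show ?thesis by (simp add: propagator_inverse' heis_def matrix_mul_assoc)
qed

lemma heis_commutator: "heis A t (commutator B C) = commutator (heis A t B) (heis A t C)"
  by (simp add: commutator_def heis_diff heis_mult)

lemma heis_deriv: "((\<lambda>t. heis A t B) has_vector_derivative heis A t (commutator A B)) (at t)"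
proof -
  have "((\<lambda>t. propagator A t ** B) has_vector_derivative A ** propagator A t ** B) (at t)"
    by (rule bounded_linear.has_vector_derivative[OF mm.bounded_linear_left]) (rule propagator_deriv)
  from mm.has_vector_derivative[OF this propagator_neg_deriv[of A t]]
  have "((\<lambda>t. heis A t B) has_vector_derivative
      - (propagator A t ** B ** (A ** propagator A (- t))) + A ** propagator A t ** B ** propagator A (- t)) (at t)"
    unfolding heis_def by (simp add: mm.minus_right)
  also have "A ** propagator A t ** B ** propagator A (- t) = heis A t (A ** B)"
    by (simp add: heis_def matrix_mul_assoc propagator_commute)
  also have "propagator A t ** B ** (A ** propagator A (- t)) = heis A t (B ** A)"
    by (simp add: heis_def matrix_mul_assoc)
  finally show ?thesis by (simp add: commutator_def heis_diff)
qed

lemma norm_heis_le: "antihermitian A \<Longrightarrow> norm (heis A t B) \<le> norm B"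
proof -
  assume A: "antihermitian A"
  have "norm (heis A t B) \<le> norm (propagator A t ** B) * op_norm (propagator A (- t))"
    unfolding heis_def by (rule norm_mult_le_op_norm_right)
  also have "\<dots> \<le> (op_norm (propagator A t) * norm B) * op_norm (propagator A (- t))"
    by (intro mult_right_mono norm_mult_le_op_norm_left) simp
  also have "\<dots> \<le> (1 * norm B) * 1"
    by (intro mult_mono op_norm_unitary_le unitary_propagator A) auto
  finally show ?thesis by simp
qed

lemma norm_heis: "antihermitian A \<Longrightarrow> norm (heis A t B) = norm B"
  using norm_heis_le[of A t B] norm_heis_le[of A "- t" "heis A t B"]
  by (simp flip: heis_add)

lemma op_norm_heis_le: "antihermitian A \<Longrightarrow> op_norm (heis A t B) \<le> op_norm B"
proof -
  assume A: "antihermitian A"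
  have "op_norm (heis A t B) \<le> op_norm (propagator A t ** B) * op_norm (propagator A (- t))"
    unfolding heis_def by (rule op_norm_mult_le)
  also have "\<dots> \<le> (op_norm (propagator A t) * op_norm B) * op_norm (propagator A (- t))"
    by (intro mult_right_mono op_norm_mult_le) simp
  also have "\<dots> \<le> (1 * op_norm B) * 1"
    by (intro mult_mono op_norm_unitary_le unitary_propagator A) auto
  finally show ?thesis by simp
qed

lemma heis_uminus: "heis (- A) t B = heis A (- t) B"
  by (simp add: heis_def propagator_def)

section \<open>Duhamel and Taylor estimates for commutators\<close>

lemma heis_commutator_self: "heis A t (commutator A B) = commutator A (heis A t B)"
proof -
  have "heis A t A = A ** (propagator A t ** propagator A (- t))"
    by (simp add: heis_def propagator_commute matrix_mul_assoc)
  then show ?thesis by (simp add: heis_commutator propagator_inverse)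
qed

text \<open>Undoing the evolution under \<open>A\<close> leaves only the residual of the Heisenberg
  equation, which vanishes if \<open>Y\<close> itself evolves under \<open>A\<close>.\<close>

lemma heis_interaction_picture_deriv:
  assumes "(Y has_vector_derivative Y') (at s)"
  shows "((\<lambda>s. heis A (- s) (Y s)) has_vector_derivative heis A (- s) (Y' - commutator A (Y s))) (at s)"
proof -
  have 1: "((\<lambda>s. propagator A (- s) ** Y s) has_vector_derivative
      propagator A (- s) ** Y' - A ** propagator A (- s) ** Y s) (at s)"
    using mm.has_vector_derivative[OF propagator_neg_deriv[of A s] assms] by (simp add: mm.minus_left)
  have "((\<lambda>s. heis A (- s) (Y s)) has_vector_derivative
     propagator A (- s) ** Y s ** (A ** propagator A s) +
     (propagator A (- s) ** Y' - A ** propagator A (- s) ** Y s) ** propagator A s) (at s)"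
    unfolding heis_def using mm.has_vector_derivative[OF 1 propagator_deriv[of A s]] by simp
  also have "propagator A (- s) ** Y s ** (A ** propagator A s) +
     (propagator A (- s) ** Y' - A ** propagator A (- s) ** Y s) ** propagator A s
     = heis A (- s) (Y' - commutator A (Y s))"
    by (simp add: heis_def commutator_def mm.diff_left mm.diff_right matrix_mul_assoc propagator_commute)
  finally show ?thesis .
qed

text \<open>\<open>F\<close> runs forward under \<open>A'\<close> and back under \<open>A\<close>;
  it would be constant for \<open>A = A'\<close>, and \<open>F t - F 0\<close> has the norm of the
  error. A bound on the derivative takes the place of the integral in Duhamel's formula.\<close>

lemma norm_heis_diff_le:
  assumes A: "antihermitian A" and A': "antihermitian A'" and t: "0 \<le> t"
    and K: "\<And>s. 0 \<le> s \<Longrightarrow> s \<le> t \<Longrightarrow> norm (commutator (heis A' (- s) (A - A')) B) \<le> K"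
  shows "norm (heis A t B - heis A' t B) \<le> t * K"
proof -
  define F where "F s = heis A (- s) (heis A' s B)" for s
  define F' where "F' s = heis A (- s) (commutator A' (heis A' s B) - commutator A (heis A' s B))" for s
  have dF: "(F has_vector_derivative F' s) (at s)" for s
    unfolding F_def F'_def
    using heis_interaction_picture_deriv[OF heis_deriv[of A' B s], of A] by (simp add: heis_commutator_self)
  have bnd: "norm (F' s) \<le> K" if "0 \<le> s" "s \<le> t" for s
  proof -
    have "F' s = heis A (- s) (- commutator (A - A') (heis A' s B))"
      by (simp add: F'_def cm.diff_left)
    \<comment> \<open>Pulling out the evolution under \<open>A'\<close>, an isometry, shifts the
      spreading from \<open>B\<close> to \<open>A - A'\<close>, so \<open>B\<close> keeps its
      support and its operator norm.\<close>
    also have "commutator (A - A') (heis A' s B) = heis A' s (commutator (heis A' (- s) (A - A')) B)"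
      by (simp add: heis_commutator flip: heis_add)
    finally show ?thesis using K[OF that] by (simp add: norm_heis A A')
  qed
  have "norm (F t - F 0) \<le> t * K"
  proof (cases "t = 0")
    case False
    have "norm (F t - F 0) \<le> t * K - 0 * K"
    proof (rule differentiable_bound_general[OF _ _ _ dF _ bnd])
      show "0 < t" using False t by simp
      show "continuous_on {0..t} F"
        by (rule continuous_on_vector_derivative[OF has_vector_derivative_at_within[OF dF]])
      show "continuous_on {0..t} (\<lambda>x. x * K)" by (intro continuous_intros)
      show "((\<lambda>x. x * K) has_vector_derivative K) (at x)" for x
        unfolding has_real_derivative_iff_has_vector_derivative[symmetric]
        by (auto intro!: derivative_eq_intros)
    qed auto
    then show ?thesis by simp
  qed simp
  also have "F t - F 0 = heis A (- t) (heis A' t B - heis A t B)"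
    by (simp add: F_def heis_diff flip: heis_add)
  finally show ?thesis by (simp add: norm_heis A norm_minus_commute)
qed

text \<open>Induction on \<open>N\<close> with \<open>X\<close> arbitrary: differentiating in
  \<open>s\<close> replaces \<open>X\<close> by \<open>commutator A X\<close>, so the bound for
  \<open>N\<close> integrates to the one for \<open>Suc N\<close>. Every order retains its
  commutator with \<open>B\<close>, so that the support of \<open>B\<close> can be exploited term by
  term.\<close>

lemma norm_commutator_heis_taylor:
  assumes A: "antihermitian A" and s: "0 \<le> s"
  shows "norm (commutator (heis A s X) B) \<le>
    (\<Sum>n<N. s ^ n / fact n * norm (commutator ((commutator A ^^ n) X) B))
    + s ^ N / fact N * (2 * norm ((commutator A ^^ N) X) * op_norm B)"
  using s
proof (induction N arbitrary: X s)
  case 0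
  have "norm (commutator (heis A s X) B) \<le> 2 * norm (heis A s X) * op_norm B"
    by (rule norm_commutator_le)
  then show ?case by (simp add: norm_heis A)
next
  case (Suc N)
  define b where "b n = norm (commutator ((commutator A ^^ n) X) B)" for n
  define M where "M = 2 * norm ((commutator A ^^ Suc N) X) * op_norm B"
  \<comment> \<open>The primitive, vanishing at 0, of the bound given by the induction
    hypothesis.\<close>
  define \<phi> where "\<phi> x = (\<Sum>n<N. x ^ Suc n / fact (Suc n) * b (Suc n)) + x ^ Suc N / fact (Suc N) * M" for x :: real
  have d\<phi>: "(\<phi> has_vector_derivative (\<Sum>n<N. x ^ n / fact n * b (Suc n)) + x ^ N / fact N * M) (at x)" for x
  proof -
    have "((\<lambda>x. x ^ Suc n / fact (Suc n) * c) has_real_derivative x ^ n / fact n * c) (at x)"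
      for n and c :: real
    proof -
      have "((\<lambda>x. x ^ Suc n / fact (Suc n) * c) has_real_derivative
          (real (Suc n) * x ^ n) / fact (Suc n) * c) (at x)"
        using DERIV_pow[of "Suc n" x] by (intro DERIV_cmult_right DERIV_cdivide) simp
      then show ?thesis by (simp add: fact_Suc del: of_nat_Suc power_Suc)
    qed
    then show ?thesis
      unfolding \<phi>_def has_real_derivative_iff_has_vector_derivative[symmetric]
      by (intro DERIV_add DERIV_sum)
  qed
  have df: "((\<lambda>s. commutator (heis A s X) B) has_vector_derivative
      commutator (heis A x (commutator A X)) B) (at x)" for x
    by (rule bounded_linear.has_vector_derivative[OF cm.bounded_linear_left heis_deriv])
  have bnd: "norm (commutator (heis A x (commutator A X)) B) \<le>
      (\<Sum>n<N. x ^ n / fact n * b (Suc n)) + x ^ N / fact N * M" if "0 \<le> x" for x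
    using Suc.IH[OF that, of "commutator A X"] by (simp add: b_def M_def funpow_swap1)
  have "norm (commutator (heis A s X) B - commutator (heis A 0 X) B) \<le> \<phi> s - \<phi> 0"
  proof (cases "s = 0")
    case False
    show ?thesis
    proof (rule differentiable_bound_general[OF _ _ _ df d\<phi> bnd])
      show "0 < s" using False Suc.prems by simp
      show "continuous_on {0..s} (\<lambda>s. commutator (heis A s X) B)"
        by (rule continuous_on_vector_derivative[OF has_vector_derivative_at_within[OF df]])
      show "continuous_on {0..s} \<phi>"
        by (rule continuous_on_vector_derivative[OF has_vector_derivative_at_within[OF d\<phi>]])
    qed auto
  qed simp
  moreover have "\<phi> 0 = 0" by (simp add: \<phi>_def)
  ultimately have "norm (commutator (heis A s X) B) \<le> b 0 + \<phi> s"
    using norm_triangle_sub[of "commutator (heis A s X) B" "commutator (heis A 0 X) B"]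
    by (simp add: b_def)
  also have "b 0 + \<phi> s = (\<Sum>n<Suc N. s ^ n / fact n * b n) + s ^ Suc N / fact (Suc N) * M"
    unfolding \<phi>_def by (subst sum.lessThan_Suc_shift) simp
  finally show ?case by (simp only: b_def M_def)
qed

text \<open>As \<open>N\<close> tends to infinity the remainder disappears, because
  \<open>(s * K) ^ N / fact N\<close> tends to 0. The constant \<open>K\<close>, which may grow with
  the lattice, leaves no trace in the bound.\<close>

lemma norm_commutator_heis_le:
  assumes A: "antihermitian A" and s: "0 \<le> s"
    and S: "\<And>N. (\<Sum>n<N. s ^ n / fact n * norm (commutator ((commutator A ^^ n) X) B)) \<le> S"
  shows "norm (commutator (heis A s X) B) \<le> S"
proof -
  define K where "K = 2 * op_norm A"
  have comm: "norm (commutator A Y) \<le> K * norm Y" for Y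
  proof -
    have "norm (commutator A Y) = norm (commutator Y A)"
      unfolding commutator_def by (rule norm_minus_commute)
    also have "\<dots> \<le> 2 * norm Y * op_norm A" by (rule norm_commutator_le)
    finally show ?thesis by (simp add: K_def mult_ac)
  qed
  have pow: "norm ((commutator A ^^ N) X) \<le> K ^ N * norm X" for N
  proof (induction N)
    case (Suc N)
    have "norm ((commutator A ^^ Suc N) X) \<le> K * norm ((commutator A ^^ N) X)"
      using comm by simp
    also have "\<dots> \<le> K * (K ^ N * norm X)"
      using Suc by (intro mult_left_mono) (simp_all add: K_def)
    finally show ?case by (simp add: mult_ac)
  qed simp
  have le: "norm (commutator (heis A s X) B) \<le> S + inverse (fact N) * (s * K) ^ N * (2 * norm X * op_norm B)" for N
  proof -
    have "s ^ N / fact N * (2 * norm ((commutator A ^^ N) X) * op_norm B)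
      \<le> s ^ N / fact N * (2 * (K ^ N * norm X) * op_norm B)"
      using s by (intro mult_left_mono mult_right_mono pow) auto
    then show ?thesis
      using norm_commutator_heis_taylor[OF A s, of X B N] S[of N]
      by (simp add: power_mult_distrib divide_inverse mult_ac)
  qed
  have "(\<lambda>N. S + inverse (fact N) * (s * K) ^ N * (2 * norm X * op_norm B)) \<longlonglongrightarrow> S + 0 * (2 * norm X * op_norm B)"
    by (intro tendsto_add tendsto_mult tendsto_const summable_LIMSEQ_zero summable_exp)
  from Lim_bounded2[OF this, of 0] le show ?thesis by simp
qed

section \<open>Pauli words\<close>

text \<open>Full-lattice Pauli labels; \<open>None\<close> is the identity, so the sites of a string are explicit.\<close>

type_synonym 'v pauli_word = "'v \<Rightarrow> pauli option"

lemma UNIV_pauli: "UNIV = {PX, PY, PZ}"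
  using pauli.exhaust by auto

instance pauli :: finite
  by standard (simp add: UNIV_pauli)

fun pauli1 :: "pauli option \<Rightarrow> complex^2^2" where
  "pauli1 None = mat 1"
| "pauli1 (Some a) = pauli_mat a"

text \<open>Multiplication of Pauli matrices modulo phases: the Klein four-group with unit
  \<open>None\<close>.\<close>

fun pauli1_mult :: "pauli option \<Rightarrow> pauli option \<Rightarrow> pauli option" where
  "pauli1_mult None b = b"
| "pauli1_mult a None = a"
| "pauli1_mult (Some PX) (Some PX) = None"
| "pauli1_mult (Some PY) (Some PY) = None"
| "pauli1_mult (Some PZ) (Some PZ) = None"
| "pauli1_mult (Some PX) (Some PY) = Some PZ"
| "pauli1_mult (Some PY) (Some PX) = Some PZ"
| "pauli1_mult (Some PX) (Some PZ) = Some PY"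
| "pauli1_mult (Some PZ) (Some PX) = Some PY"
| "pauli1_mult (Some PY) (Some PZ) = Some PX"
| "pauli1_mult (Some PZ) (Some PY) = Some PX"

lemma pauli1_mult_None_right [simp]: "pauli1_mult a None = a"
  by (cases a) auto

lemma pauli1_mult_commute: "pauli1_mult a b = pauli1_mult b a"
  by (cases "(a, b)" rule: pauli1_mult.cases) auto

lemma pauli_option_cases: "a = None \<or> a = Some PX \<or> a = Some PY \<or> a = Some PZ"
  by (metis not_Some_eq pauli.exhaust)

lemma pauli1_mult_phase: "\<exists>z. cmod z = 1 \<and> pauli1 a ** pauli1 b = cscale_mat z (pauli1 (pauli1_mult a b))"
proof -
  define z where "z =
    (case (a, b) of (Some PX, Some PY) \<Rightarrow> \<i> | (Some PY, Some PZ) \<Rightarrow> \<i> | (Some PZ, Some PX) \<Rightarrow> \<i>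
      | (Some PY, Some PX) \<Rightarrow> - \<i> | (Some PZ, Some PY) \<Rightarrow> - \<i> | (Some PX, Some PZ) \<Rightarrow> - \<i> | _ \<Rightarrow> 1)"
  have "pauli1 a ** pauli1 b = cscale_mat z (pauli1 (pauli1_mult a b))"
    using pauli_option_cases[of a] pauli_option_cases[of b] unfolding z_def
    by (elim disjE)
      (simp_all add: cscale_mat_def vec_eq_iff forall_2 matrix_matrix_mult_def sum_2 mat_def)
  moreover have "cmod z = 1"
    using pauli_option_cases[of a] pauli_option_cases[of b] unfolding z_def
    by (elim disjE) simp_all
  ultimately show ?thesis by blast
qed

lemma pauli1_orthogonal:
  "(\<Sum>x\<in>UNIV. \<Sum>y\<in>UNIV. cnj (pauli1 a $ x $ y) * pauli1 b $ x $ y) = (if a = b then 2 else 0)"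
  using pauli_option_cases[of a] pauli_option_cases[of b]
  by (elim disjE) (simp_all add: sum_2 mat_def)

definition pauli_op :: "'v::finite pauli_word \<Rightarrow> 'v spin_op" where
  "pauli_op p = (\<chi> s s'. \<Prod>v\<in>UNIV. pauli1 (p v) $ s v $ s' v)"

definition supp :: "'v pauli_word \<Rightarrow> 'v set" where
  "supp p = {v. p v \<noteq> None}"

definition pauli_mult :: "'v pauli_word \<Rightarrow> 'v pauli_word \<Rightarrow> 'v pauli_word" where
  "pauli_mult p q = (\<lambda>v. pauli1_mult (p v) (q v))"

text \<open>Distributivity over configurations. It reduces scalar products and matrix products of
  Pauli words to a single site.\<close>

lemma sum_prod_fun:
  fixes f :: "'v::finite \<Rightarrow> 'a::finite \<Rightarrow> 'b::comm_semiring_1"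
  shows "(\<Sum>s\<in>UNIV. \<Prod>v\<in>UNIV. f v (s v)) = (\<Prod>v\<in>UNIV. \<Sum>x\<in>UNIV. f v x)"
  using prod_sum_PiE[of "UNIV :: 'v set" "\<lambda>_. UNIV :: 'a set" f] by (simp add: PiE_UNIV_domain)

lemma sum_prod_fun2:
  fixes f :: "'v::finite \<Rightarrow> 'a::finite \<Rightarrow> 'a \<Rightarrow> 'b::comm_semiring_1"
  shows "(\<Sum>s\<in>UNIV. \<Sum>s'\<in>UNIV. \<Prod>v\<in>UNIV. f v (s v) (s' v))
    = (\<Prod>v\<in>UNIV. \<Sum>x\<in>UNIV. \<Sum>y\<in>UNIV. f v x y)"
proof -
  have "(\<Sum>s'\<in>UNIV. \<Prod>v\<in>UNIV. f v (s v) (s' v)) = (\<Prod>v\<in>UNIV. \<Sum>y\<in>UNIV. f v (s v) y)" for s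
    by (rule sum_prod_fun)
  then show ?thesis
    by (simp only: sum_prod_fun[of "\<lambda>v x. \<Sum>y\<in>UNIV. f v x y"])
qed

lemma pauli_op_orthogonal:
  "(\<Sum>s\<in>UNIV. \<Sum>s'\<in>UNIV. cnj (pauli_op p $ s $ s') * pauli_op q $ s $ s')
    = (if p = q then of_nat CARD('v \<Rightarrow> 2) else (0::complex))" for p q :: "'v::finite pauli_word"
proof -
  have "(\<Sum>s\<in>UNIV. \<Sum>s'\<in>UNIV. cnj (pauli_op p $ s $ s') * pauli_op q $ s $ s')
    = (\<Prod>v\<in>UNIV. if p v = q v then 2 else 0)"
    by (simp only: pauli_op_def vec_lambda_beta cnj_prod prod.distrib[symmetric]
        sum_prod_fun2[of "\<lambda>v x y. cnj (pauli1 (p v) $ x $ y) * pauli1 (q v) $ x $ y"] pauli1_orthogonal)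
  also have "\<dots> = (if p = q then 2 ^ CARD('v) else 0)"
    by (auto simp: fun_eq_iff)
  finally show ?thesis by (simp add: card_fun)
qed

lemma pauli_op_mult_nth:
  "(pauli_op p ** pauli_op q) $ s $ s' = (\<Prod>v\<in>UNIV. (pauli1 (p v) ** pauli1 (q v)) $ s v $ s' v)"
proof -
  have "(pauli_op p ** pauli_op q) $ s $ s' =
     (\<Prod>v\<in>UNIV. \<Sum>y\<in>UNIV. pauli1 (p v) $ s v $ y * pauli1 (q v) $ y $ s' v)"
    by (simp only: matrix_matrix_mult_def pauli_op_def vec_lambda_beta prod.distrib[symmetric]
        sum_prod_fun[of "\<lambda>v y. pauli1 (p v) $ s v $ y * pauli1 (q v) $ y $ s' v"])
  then show ?thesis by (simp add: matrix_matrix_mult_def)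
qed

lemma pauli_op_mult:
  "\<exists>z. cmod z = 1 \<and> pauli_op p ** pauli_op q = cscale_mat z (pauli_op (pauli_mult p q))"
proof -
  obtain z where z: "cmod (z a b) = 1"
    and zm: "pauli1 a ** pauli1 b = cscale_mat (z a b) (pauli1 (pauli1_mult a b))" for a b
    using pauli1_mult_phase by metis
  have "(pauli_op p ** pauli_op q) $ s $ s' = (\<Prod>v\<in>UNIV. z (p v) (q v)) * pauli_op (pauli_mult p q) $ s $ s'" for s s'
    unfolding pauli_op_mult_nth
    by (simp add: zm cscale_mat_def pauli_op_def pauli_mult_def prod.distrib)
  then show ?thesis
    by (intro exI[of _ "\<Prod>v\<in>UNIV. z (p v) (q v)"]) (simp add: vec_eq_iff cscale_mat_def z flip: prod_norm)
qed

lemma pauli_mult_commute: "pauli_mult p q = pauli_mult q p"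
  by (simp add: pauli_mult_def pauli1_mult_commute)

lemma supp_pauli_mult: "supp (pauli_mult p q) \<subseteq> supp p \<union> supp q"
  by (auto simp: supp_def pauli_mult_def)

text \<open>This is why a word that sticks out of \<open>Y\<close> still does so, at the same sites,
  after multiplication by a word inside \<open>Y\<close>.\<close>

lemma supp_pauli_mult_outside: "v \<notin> supp q \<Longrightarrow> v \<in> supp (pauli_mult q p) \<longleftrightarrow> v \<in> supp p"
  by (auto simp: supp_def pauli_mult_def)

lemma pauli_op_commute_disjoint:
  assumes "supp p \<inter> supp q = {}"
  shows "pauli_op p ** pauli_op q = pauli_op q ** pauli_op p"
proof -
  have "p v = None \<or> q v = None" for v using assms by (auto simp: supp_def)
  then have "pauli1 (p v) ** pauli1 (q v) = pauli1 (q v) ** pauli1 (p v)" for v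
    by (metis pauli1.simps(1) matrix_mul_lid matrix_mul_rid)
  then show ?thesis by (simp add: vec_eq_iff pauli_op_mult_nth)
qed

text \<open>The products in the two orders are the same word with phases of modulus 1, so their
  difference is one word with a coefficient of modulus at most 2.\<close>

lemma pauli_op_commutator:
  "\<exists>z. cmod z \<le> 2 \<and> commutator (pauli_op q) (pauli_op p) = cscale_mat z (pauli_op (pauli_mult q p))
    \<and> (supp q \<inter> supp p = {} \<longrightarrow> z = 0)"
proof (cases "supp q \<inter> supp p = {}")
  case True
  then show ?thesis
    by (intro exI[of _ 0]) (auto simp: commutator_def pauli_op_commute_disjoint vec_eq_iff)
next
  case False
  obtain z where z: "cmod z = 1" "pauli_op q ** pauli_op p = cscale_mat z (pauli_op (pauli_mult q p))"
    using pauli_op_mult by blast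
  obtain w where w: "cmod w = 1" "pauli_op p ** pauli_op q = cscale_mat w (pauli_op (pauli_mult q p))"
    using pauli_op_mult[of p q] pauli_mult_commute by metis
  have "cmod (z - w) \<le> 2" using norm_triangle_ineq4[of z w] z w by simp
  then show ?thesis using False
    by (intro exI[of _ "z - w"]) (simp add: commutator_def z w vec_eq_iff algebra_simps)
qed

section \<open>Parseval identity and commutators in Pauli coordinates\<close>

definition pauli_sum :: "('v::finite pauli_word \<Rightarrow> complex) \<Rightarrow> 'v spin_op" where
  "pauli_sum a = (\<Sum>p\<in>UNIV. cscale_mat (a p) (pauli_op p))"

lemma pauli_sum_diff: "pauli_sum a - pauli_sum b = pauli_sum (\<lambda>p. a p - b p)"
  by (simp add: pauli_sum_def vec_eq_iff algebra_simps flip: sum_subtractf)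

lemma cscale_pauli_sum: "cscale_mat c (pauli_sum a) = pauli_sum (\<lambda>p. c * a p)"
  by (simp add: pauli_sum_def vec_eq_iff sum_distrib_left mult.assoc)

text \<open>Parseval's identity for the orthogonal family of Pauli words, all of squared norm
  \<open>CARD('v \<Rightarrow> 2)\<close>.\<close>

lemma norm_pauli_sum:
  "(norm (pauli_sum a :: 'v::finite spin_op))\<^sup>2 = real CARD('v \<Rightarrow> 2) * (\<Sum>p\<in>UNIV. (cmod (a p))\<^sup>2)"
proof -
  let ?A = "pauli_sum a :: 'v spin_op"
  have "complex_of_real ((norm ?A)\<^sup>2) = (\<Sum>s\<in>UNIV. \<Sum>s'\<in>UNIV. cnj (?A $ s $ s') * ?A $ s $ s')"
    unfolding norm_mat_sq of_real_sum complex_norm_square by (simp add: mult.commute)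
  also have "\<dots> = (\<Sum>s\<in>UNIV. \<Sum>s'\<in>UNIV. \<Sum>p\<in>UNIV. \<Sum>q\<in>UNIV.
       cnj (a p) * a q * (cnj (pauli_op p $ s $ s') * pauli_op q $ s $ s'))"
  proof -
    have "cnj (?A $ s $ s') * ?A $ s $ s' = (\<Sum>p\<in>UNIV. \<Sum>q\<in>UNIV.
       cnj (a p) * a q * (cnj (pauli_op p $ s $ s') * pauli_op q $ s $ s'))" for s s'
      unfolding pauli_sum_def sum_component cnj_sum sum_product cscale_mat_nth complex_cnj_mult
      by (intro sum.cong refl) (simp only: mult_ac)
    then show ?thesis by simp
  qed
  also have "\<dots> = (\<Sum>p\<in>UNIV. \<Sum>q\<in>UNIV. \<Sum>s\<in>UNIV. \<Sum>s'\<in>UNIV.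
       cnj (a p) * a q * (cnj (pauli_op p $ s $ s') * pauli_op q $ s $ s'))"
    (is "_ = ?S")
  proof -
    have sw: "(\<Sum>s'\<in>UNIV. \<Sum>p\<in>UNIV. \<Sum>q\<in>UNIV. f s' p q) = (\<Sum>p\<in>UNIV. \<Sum>q\<in>UNIV. \<Sum>s'\<in>UNIV. f s' p q)"
      for f :: "('v \<Rightarrow> 2) \<Rightarrow> 'v pauli_word \<Rightarrow> 'v pauli_word \<Rightarrow> complex"
      by (subst sum.swap, intro sum.cong refl, rule sum.swap)
    show ?thesis by (simp only: sw)
  qed
  also have "\<dots> = (\<Sum>p\<in>UNIV. \<Sum>q\<in>UNIV. cnj (a p) * a q * (if p = q then of_nat CARD('v \<Rightarrow> 2) else 0))"
    by (simp only: sum_distrib_left[symmetric] pauli_op_orthogonal)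
  also have "\<dots> = of_real (real CARD('v \<Rightarrow> 2) * (\<Sum>p\<in>UNIV. (cmod (a p))\<^sup>2))"
  proof -
    have "(\<Sum>q\<in>UNIV. cnj (a p) * a q * (if p = q then of_nat CARD('v \<Rightarrow> 2) else 0))
        = of_nat CARD('v \<Rightarrow> 2) * of_real ((cmod (a p))\<^sup>2)" for p
      unfolding mult_delta_right complex_norm_square by (simp only: sum.delta' finite) simp
    then show ?thesis by (simp add: sum_distrib_left)
  qed
  finally show ?thesis by (simp only: of_real_eq_iff)
qed

definition pauli_commutator_coeff :: "'v::finite pauli_word \<Rightarrow> 'v pauli_word \<Rightarrow> complex" where
  "pauli_commutator_coeff q p = (SOME z. cmod z \<le> 2 \<and>
      commutator (pauli_op q) (pauli_op p) = cscale_mat z (pauli_op (pauli_mult q p)) \<and>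
      (supp q \<inter> supp p = {} \<longrightarrow> z = 0))"

lemma pauli_commutator_coeff:
  "cmod (pauli_commutator_coeff q p) \<le> 2"
  "commutator (pauli_op q) (pauli_op p) = cscale_mat (pauli_commutator_coeff q p) (pauli_op (pauli_mult q p))"
  "supp q \<inter> supp p = {} \<Longrightarrow> pauli_commutator_coeff q p = 0"
  using someI_ex[OF pauli_op_commutator[of q p]] unfolding pauli_commutator_coeff_def by blast+

text \<open>The commutator in Pauli coordinates; iterated commutators become iterates of a map on
  coefficient functions.\<close>

definition commutator_coeff ::
  "('v::finite pauli_word \<Rightarrow> complex) \<Rightarrow> ('v pauli_word \<Rightarrow> complex) \<Rightarrow> 'v pauli_word \<Rightarrow> complex" where
  "commutator_coeff b a r =
    (\<Sum>(q, p) | pauli_mult q p = r. b q * a p * pauli_commutator_coeff q p)"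

lemma commutator_cscale: "commutator (cscale_mat c A) (cscale_mat d B) = cscale_mat (c * d) (commutator A B)"
  by (simp add: commutator_def cscale_mat_mult_left cscale_mat_mult_right vec_eq_iff algebra_simps)

lemma cscale_mat_cscale: "cscale_mat c (cscale_mat d A) = cscale_mat (c * d) A"
  by (simp add: vec_eq_iff mult.assoc)

lemma cscale_mat_sum: "cscale_mat (sum f I) A = (\<Sum>x\<in>I. cscale_mat (f x) A)"
  by (simp add: vec_eq_iff sum_distrib_right)

lemma commutator_pauli_sum:
  "commutator (pauli_sum b) (pauli_sum a) = pauli_sum (commutator_coeff b a :: 'v::finite pauli_word \<Rightarrow> complex)"
proof -
  define G where "G x = (case x of (q, p) \<Rightarrow>
     cscale_mat (b q * a p * pauli_commutator_coeff q p) (pauli_op (pauli_mult q p)))" for x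
  have "commutator (pauli_sum b) (pauli_sum a) = (\<Sum>q\<in>UNIV. \<Sum>p\<in>UNIV. G (q, p))"
    unfolding pauli_sum_def cm.sum_left cm.sum_right
    by (subst sum.swap)
      (simp only: G_def commutator_cscale pauli_commutator_coeff cscale_mat_cscale prod.case)
  also have "\<dots> = sum G UNIV"
    by (simp add: sum.cartesian_product flip: UNIV_Times_UNIV)
  also have "\<dots> = (\<Sum>r\<in>UNIV. \<Sum>x | x \<in> UNIV \<and> (case x of (q, p) \<Rightarrow> pauli_mult q p) = r. G x)"
    by (rule sum.group[symmetric]) auto
  also have "\<dots> = (\<Sum>r\<in>UNIV. cscale_mat (commutator_coeff b a r) (pauli_op r))"
  proof (rule sum.cong[OF refl])
    fix r
    show "(\<Sum>x | x \<in> UNIV \<and> (case x of (q, p) \<Rightarrow> pauli_mult q p) = r. G x)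
      = cscale_mat (commutator_coeff b a r) (pauli_op r)"
      unfolding commutator_coeff_def cscale_mat_sum
      by (intro sum.cong) (auto simp: G_def)
  qed
  finally show ?thesis by (simp add: pauli_sum_def)
qed

lemma norm_commutator_coeff_le:
  "cmod (commutator_coeff b a r) \<le>
    (\<Sum>(q, p) | pauli_mult q p = r \<and> supp q \<inter> supp p \<noteq> {}. 2 * cmod (b q) * cmod (a p))"
proof -
  have "commutator_coeff b a r = (\<Sum>(q, p) | pauli_mult q p = r \<and> supp q \<inter> supp p \<noteq> {}.
      b q * a p * pauli_commutator_coeff q p)"
    unfolding commutator_coeff_def
    by (intro sum.mono_neutral_right) (auto simp: pauli_commutator_coeff)
  also have "cmod \<dots> \<le> (\<Sum>(q, p) | pauli_mult q p = r \<and> supp q \<inter> supp p \<noteq> {}. 2 * cmod (b q) * cmod (a p))"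
  proof (rule sum_norm_le, clarify)
    fix q p :: "'a pauli_word"
    have "cmod (b q * a p * pauli_commutator_coeff q p) \<le> cmod (b q) * cmod (a p) * 2"
      unfolding norm_mult using pauli_commutator_coeff(1) by (intro mult_left_mono) auto
    then show "cmod (b q * a p * pauli_commutator_coeff q p) \<le> 2 * cmod (b q) * cmod (a p)"
      by (simp add: mult_ac)
  qed
  finally show ?thesis .
qed

section \<open>Supports\<close>

text \<open>Trades the existential local factor for two conditions on matrix entries, which can be
  checked directly for sums, products and limits.\<close>

lemma supported_on_iff:
  "supported_on X A \<longleftrightarrow>
    (\<forall>s s'. (\<exists>v. v \<notin> X \<and> s v \<noteq> s' v) \<longrightarrow> A $ s $ s' = 0) \<and>
    (\<forall>s s' u u'. (\<forall>v\<in>X. s v = u v \<and> s' v = u' v) \<longrightarrow> (\<forall>v. v \<notin> X \<longrightarrow> s v = s' v \<and> u v = u' v)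
      \<longrightarrow> A $ s $ s' = A $ u $ u')" (is "_ \<longleftrightarrow> ?R")
proof
  assume "supported_on X A"
  then obtain B where B: "\<And>s s'. A $ s $ s' = (if \<forall>v\<in>-X. s v = s' v then B (restrict s X) (restrict s' X) else 0)"
    by (auto simp: supported_on_def)
  have "restrict s X = restrict u X" if "\<forall>v\<in>X. s v = u v" for s u :: "'a \<Rightarrow> 2"
    using that by (auto simp: restrict_def)
  note res = this
  have "A $ s $ s' = A $ u $ u'"
    if "\<forall>v\<in>X. s v = u v \<and> s' v = u' v" "\<forall>v. v \<notin> X \<longrightarrow> s v = s' v \<and> u v = u' v" for s s' u u'
    using that res[of s u] res[of s' u'] by (simp add: B)
  then show ?R by (auto simp: B)
next
  assume R: ?R
  \<comment> \<open>\<open>restrict\<close> puts the same \<open>undefined\<close> at every site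
    outside \<open>X\<close>, so the restricted configurations agree there and the second condition
    applies to them.\<close>
  have "A $ s $ s' = (if \<forall>v\<in>-X. s v = s' v then A $ restrict s X $ restrict s' X else 0)" for s s'
  proof (cases "\<forall>v\<in>-X. s v = s' v")
    case True
    then have "A $ s $ s' = A $ restrict s X $ restrict s' X"
      by (intro R[THEN conjunct2, rule_format]) (auto simp: restrict_def)
    then show ?thesis using True by simp
  next
    case False
    then show ?thesis using R by auto
  qed
  then show "supported_on X A"
    unfolding supported_on_def by (intro exI[of _ "\<lambda>x y. A $ x $ y"]) blast
qed

lemma supported_on_zero: "supported_on X A \<Longrightarrow> v \<notin> X \<Longrightarrow> s v \<noteq> s' v \<Longrightarrow> A $ s $ s' = 0"
  unfolding supported_on_iff by blast

lemma supported_on_eq: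
  assumes "supported_on X A"
    and "\<And>v. v \<in> X \<Longrightarrow> s v = u v" "\<And>v. v \<in> X \<Longrightarrow> s' v = u' v"
    and "\<And>v. v \<notin> X \<Longrightarrow> s v = s' v" "\<And>v. v \<notin> X \<Longrightarrow> u v = u' v"
  shows "A $ s $ s' = A $ u $ u'"
  using assms unfolding supported_on_iff by blast

lemma supported_onI:
  assumes "\<And>s s' v. v \<notin> X \<Longrightarrow> s v \<noteq> s' v \<Longrightarrow> A $ s $ s' = 0"
    and "\<And>s s' u u'. (\<And>v. v \<in> X \<Longrightarrow> s v = u v) \<Longrightarrow> (\<And>v. v \<in> X \<Longrightarrow> s' v = u' v) \<Longrightarrow>
      (\<And>v. v \<notin> X \<Longrightarrow> s v = s' v) \<Longrightarrow> (\<And>v. v \<notin> X \<Longrightarrow> u v = u' v) \<Longrightarrow> A $ s $ s' = A $ u $ u'"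
  shows "supported_on X A"
  unfolding supported_on_iff using assms by blast

lemma supported_on_mono:
  assumes A: "supported_on X A" and XY: "X \<subseteq> Y"
  shows "supported_on Y A"
proof (rule supported_onI)
  fix s s' :: "'a \<Rightarrow> 2" and v assume "v \<notin> Y" "s v \<noteq> s' v"
  then show "A $ s $ s' = 0" using supported_on_zero[OF A, of v] XY by blast
next
  fix s s' u u' :: "'a \<Rightarrow> 2"
  assume *: "\<And>v. v \<in> Y \<Longrightarrow> s v = u v" "\<And>v. v \<in> Y \<Longrightarrow> s' v = u' v"
    "\<And>v. v \<notin> Y \<Longrightarrow> s v = s' v" "\<And>v. v \<notin> Y \<Longrightarrow> u v = u' v"
  show "A $ s $ s' = A $ u $ u'"
  \<comment> \<open>A difference outside \<open>X\<close> must lie in \<open>Y\<close>, hence is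
    shared by \<open>u\<close> and \<open>u'\<close>, and both entries vanish; otherwise the support
    on \<open>X\<close> applies.\<close>
  proof (cases "\<exists>v. v \<notin> X \<and> s v \<noteq> s' v")
    case True
    then obtain v where v: "v \<notin> X" "s v \<noteq> s' v" by blast
    then have "u v \<noteq> u' v" using * by (cases "v \<in> Y") auto
    with v show ?thesis by (simp add: supported_on_zero[OF A])
  next
    case False
    then have "u v = u' v" if "v \<notin> X" for v using * that by (cases "v \<in> Y") auto
    with False show ?thesis using * XY by (intro supported_on_eq[OF A]) auto
  qed
qed

lemma supported_on_sum:
  assumes "\<And>x. x \<in> I \<Longrightarrow> supported_on X (f x)"
  shows "supported_on X (\<Sum>x\<in>I. f x)"
proof (rule supported_onI)
  show "sum f I $ s $ s' = 0" if "v \<notin> X" "s v \<noteq> s' v" for s s' v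
    using supported_on_zero[OF assms, where s = s and s' = s', OF _ that] by simp
  show "sum f I $ s $ s' = sum f I $ u $ u'"
    if "\<And>v. v \<in> X \<Longrightarrow> s v = u v" "\<And>v. v \<in> X \<Longrightarrow> s' v = u' v"
      "\<And>v. v \<notin> X \<Longrightarrow> s v = s' v" "\<And>v. v \<notin> X \<Longrightarrow> u v = u' v" for s s' u u'
    using supported_on_eq[OF assms, of _ s u s' u', OF _ that] by simp
qed

lemma supported_on_map_matrix:
  assumes A: "supported_on X A" and f: "f 0 = 0"
  shows "supported_on X (map_matrix f A)"
proof (rule supported_onI)
  show "map_matrix f A $ s $ s' = 0" if "v \<notin> X" "s v \<noteq> s' v" for s s' v
    using supported_on_zero[OF A, where s = s and s' = s', OF that] f by simp
  show "map_matrix f A $ s $ s' = map_matrix f A $ u $ u'"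
    if "\<And>v. v \<in> X \<Longrightarrow> s v = u v" "\<And>v. v \<in> X \<Longrightarrow> s' v = u' v"
      "\<And>v. v \<notin> X \<Longrightarrow> s v = s' v" "\<And>v. v \<notin> X \<Longrightarrow> u v = u' v" for s s' u u'
    using supported_on_eq[OF A, of s u s' u', OF that] by simp
qed

lemma supported_on_cscale: "supported_on X A \<Longrightarrow> supported_on X (cscale_mat c A)"
  unfolding cscale_mat_def by (rule supported_on_map_matrix) simp_all

lemma supported_on_scaleR: "supported_on X A \<Longrightarrow> supported_on X (c *\<^sub>R A)"
proof -
  assume "supported_on X A"
  then have "supported_on X (cscale_mat (of_real c) A)" by (rule supported_on_cscale)
  also have "cscale_mat (of_real c) A = c *\<^sub>R A"
    by (simp add: vec_eq_iff scaleR_conv_of_real[where 'a = complex])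
  finally show ?thesis .
qed

lemma supported_on_1: "supported_on X (mat 1)"
proof (rule supported_onI)
  fix s s' u u' :: "'a \<Rightarrow> 2"
  assume *: "\<And>v. v \<in> X \<Longrightarrow> s v = u v" "\<And>v. v \<in> X \<Longrightarrow> s' v = u' v"
    "\<And>v. v \<notin> X \<Longrightarrow> s v = s' v" "\<And>v. v \<notin> X \<Longrightarrow> u v = u' v"
  then have "s = s' \<longleftrightarrow> u = u'" unfolding fun_eq_iff by metis
  then show "mat 1 $ s $ s' = mat 1 $ u $ u'" by (simp add: mat_def)
qed (auto simp: mat_def)

lemma supported_on_mult:
  assumes A: "supported_on X A" and B: "supported_on X B"
  shows "supported_on X (A ** B)"
proof (rule supported_onI)
  fix s s' :: "'a \<Rightarrow> 2" and v assume v: "v \<notin> X" "s v \<noteq> s' v"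
  have "A $ s $ w * B $ w $ s' = 0" for w
  proof (cases "s v = w v")
    case True
    then have "B $ w $ s' = 0" using v by (intro supported_on_zero[OF B, of v]) auto
    then show ?thesis by simp
  next
    case False
    then have "A $ s $ w = 0" using v by (intro supported_on_zero[OF A, of v]) auto
    then show ?thesis by simp
  qed
  then show "(A ** B) $ s $ s' = 0"
    unfolding matrix_matrix_mult_def vec_lambda_beta by (intro sum.neutral) blast
next
  fix s s' u u' :: "'a \<Rightarrow> 2"
  assume *: "\<And>v. v \<in> X \<Longrightarrow> s v = u v" "\<And>v. v \<in> X \<Longrightarrow> s' v = u' v"
    "\<And>v. v \<notin> X \<Longrightarrow> s v = s' v" "\<And>v. v \<notin> X \<Longrightarrow> u v = u' v"
  \<comment> \<open>Only intermediate configurations that agree with \<open>x\<close> outside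
    \<open>X\<close> contribute.\<close>
  have red: "(A ** B) $ x $ y = (\<Sum>w | \<forall>v. v \<notin> X \<longrightarrow> w v = x v. A $ x $ w * B $ w $ y)" for x y
    unfolding matrix_matrix_mult_def vec_lambda_beta
  proof (rule sum.mono_neutral_right, simp, simp, clarify)
    fix w v assume "v \<notin> X" "A $ x $ w * B $ w $ y \<noteq> 0"
    then show "w v = x v" using supported_on_zero[OF A, of v x w] by fastforce
  qed
  show "(A ** B) $ s $ s' = (A ** B) $ u $ u'"
    unfolding red
  proof (rule sum.reindex_bij_witness[of _ "\<lambda>w v. if v \<in> X then w v else s v" "\<lambda>w v. if v \<in> X then w v else u v"])
    fix w assume w: "w \<in> {w. \<forall>v. v \<notin> X \<longrightarrow> w v = s v}"
    let ?w = "\<lambda>v. if v \<in> X then w v else u v"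
    have "A $ s $ w = A $ u $ ?w" using * w by (intro supported_on_eq[OF A]) auto
    moreover have "B $ w $ s' = B $ ?w $ u'" using * w by (intro supported_on_eq[OF B]) auto
    ultimately show "A $ u $ ?w * B $ ?w $ u' = A $ s $ w * B $ w $ s'" by simp
  qed auto
qed

lemma supported_on_exp_mat:
  assumes A: "supported_on X A"
  shows "supported_on X (exp_mat A)"
proof -
  have pow: "supported_on X (pow_mat A n)" for n
    by (induction n) (simp_all add: supported_on_1 pow_mat_Suc supported_on_mult A)
  show ?thesis
  proof (rule supported_onI)
    show "exp_mat A $ s $ s' = 0" if "v \<notin> X" "s v \<noteq> s' v" for s s' v
      using exp_mat_nth[of A s s'] by (simp add: supported_on_zero[OF pow, where s = s and s' = s', OF that] sums_iff)
    show "exp_mat A $ s $ s' = exp_mat A $ u $ u'"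
      if "\<And>v. v \<in> X \<Longrightarrow> s v = u v" "\<And>v. v \<in> X \<Longrightarrow> s' v = u' v"
        "\<And>v. v \<notin> X \<Longrightarrow> s v = s' v" "\<And>v. v \<notin> X \<Longrightarrow> u v = u' v" for s s' u u'
      using exp_mat_nth[of A s s'] exp_mat_nth[of A u u']
      by (simp add: supported_on_eq[OF pow, of s u s' u', OF that] sums_iff)
  qed
qed

lemma supported_on_heis: "supported_on X A \<Longrightarrow> supported_on X B \<Longrightarrow> supported_on X (heis A t B)"
  unfolding heis_def propagator_def
  by (intro supported_on_mult supported_on_exp_mat supported_on_scaleR)

lemma sum_UNIV_single:
  fixes f :: "'a::finite \<Rightarrow> 'b::comm_monoid_add"
  assumes "\<And>x. x \<noteq> u \<Longrightarrow> f x = 0"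
  shows "sum f UNIV = f u"
proof -
  have "sum f UNIV = sum f {u}" using assms by (intro sum.mono_neutral_right) auto
  then show ?thesis by simp
qed

text \<open>Argued on matrix entries, since \<open>A\<close> comes without a Pauli expansion: in
  each order one intermediate configuration survives, and both orders give the same product.\<close>

lemma pauli_op_commute_supported_on:
  fixes A :: "'v::finite spin_op"
  assumes A: "supported_on X A" and p: "supp p \<inter> X = {}"
  shows "commutator (pauli_op p) A = 0"
proof -
  have one: "pauli1 (p v) = mat 1" if "v \<in> X" for v
  proof -
    have "p v = None" using p that by (auto simp: supp_def)
    then show ?thesis by simp
  qed
  have P0: "pauli_op p $ s $ s' = 0" if "v \<in> X" "s v \<noteq> s' v" for s s' v
  proof -
    have "pauli1 (p v) $ s v $ s' v = 0" using one that by (simp add: mat_def)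
    then show ?thesis unfolding pauli_op_def vec_lambda_beta by (intro prod_zero) auto
  qed
  have "(pauli_op p ** A) $ s $ s' = (A ** pauli_op p) $ s $ s'" for s s'
  proof -
    \<comment> \<open>\<open>pauli_op p\<close> is diagonal on \<open>X\<close> and \<open>A\<close>
      is diagonal off \<open>X\<close>, which forces the intermediate configuration on both parts;
      \<open>w\<close> is the one for the opposite order.\<close>
    define u where "u v = (if v \<in> X then s v else s' v)" for v
    define w where "w v = (if v \<in> X then s' v else s v)" for v
    have "pauli_op p $ s $ x * A $ x $ s' = 0" if x: "x \<noteq> u" for x
    proof -
      obtain v where v: "x v \<noteq> u v" using x by (auto simp: fun_eq_iff)
      have "pauli_op p $ s $ x = 0 \<or> A $ x $ s' = 0"
        using v P0[of v s x] supported_on_zero[OF A, of v x s'] by (cases "v \<in> X") (auto simp: u_def)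
      then show ?thesis by auto
    qed
    then have l: "(pauli_op p ** A) $ s $ s' = pauli_op p $ s $ u * A $ u $ s'"
      unfolding matrix_matrix_mult_def vec_lambda_beta by (rule sum_UNIV_single)
    have "A $ s $ x * pauli_op p $ x $ s' = 0" if x: "x \<noteq> w" for x
    proof -
      obtain v where v: "x v \<noteq> w v" using x by (auto simp: fun_eq_iff)
      have "A $ s $ x = 0 \<or> pauli_op p $ x $ s' = 0"
        using v P0[of v x s'] supported_on_zero[OF A, of v s x] by (cases "v \<in> X") (auto simp: w_def)
      then show ?thesis by auto
    qed
    then have r: "(A ** pauli_op p) $ s $ s' = A $ s $ w * pauli_op p $ w $ s'"
      unfolding matrix_matrix_mult_def vec_lambda_beta by (rule sum_UNIV_single)
    have "A $ u $ s' = A $ s $ w"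
      by (intro supported_on_eq[OF A]) (simp_all add: u_def w_def)
    moreover have "pauli_op p $ s $ u = pauli_op p $ w $ s'"
      unfolding pauli_op_def vec_lambda_beta
      by (intro prod.cong refl) (simp add: one mat_def u_def w_def)
    ultimately show ?thesis by (simp add: l r)
  qed
  then show ?thesis by (simp add: commutator_def vec_eq_iff)
qed

section \<open>Short-time spreading of Pauli weight\<close>

text \<open>On the diagonal this is the weight through one site, controlled by \<open>g\<close>; off
  the diagonal it carries the power-law decay.\<close>

definition pair_mass :: "('v::finite pauli_word \<Rightarrow> complex) \<Rightarrow> 'v \<Rightarrow> 'v \<Rightarrow> real" where
  "pair_mass a x y = (\<Sum>p\<in>UNIV. of_bool (x \<in> supp p \<and> y \<in> supp p) * cmod (a p))"

lemma pair_mass_nonneg: "0 \<le> pair_mass a x y"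
  by (simp add: pair_mass_def sum_nonneg)

lemma pair_mass_mono: "(\<And>p. cmod (a p) \<le> cmod (b p)) \<Longrightarrow> pair_mass a x y \<le> pair_mass b x y"
  unfolding pair_mass_def by (intro sum_mono mult_left_mono) auto

lemma norm_commutator_pauli_sum_le:
  fixes a :: "'v::finite pauli_word \<Rightarrow> complex"
  assumes B: "supported_on X B" "op_norm B \<le> 1"
    and a: "\<And>p. a p \<noteq> 0 \<Longrightarrow> \<not> supp p \<subseteq> Y"
  shows "norm (commutator (pauli_sum a) B) \<le>
    2 * (sqrt (real CARD('v \<Rightarrow> 2)) * sqrt (\<Sum>x\<in>X. \<Sum>y\<in>-Y. (pair_mass a x y)\<^sup>2))"
proof -
  \<comment> \<open>Words disjoint from \<open>X\<close> commute with \<open>B\<close>. They are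
    dropped before the norm is estimated, so that only words near \<open>X\<close> are
    counted.\<close>
  define a' where "a' p = (if supp p \<inter> X = {} then 0 else a p)" for p
  have "pauli_sum a - pauli_sum a' = (\<Sum>p\<in>UNIV. cscale_mat (a p - a' p) (pauli_op p))"
    unfolding pauli_sum_diff by (simp add: pauli_sum_def)
  then have "commutator (pauli_sum a) B - commutator (pauli_sum a') B
      = (\<Sum>p\<in>UNIV. cscale_mat (a p - a' p) (commutator (pauli_op p) B))"
    by (simp add: cm.sum_left commutator_cscale_left flip: cm.diff_left)
  also have "\<dots> = 0"
  proof (rule sum.neutral, safe)
    fix p
    show "cscale_mat (a p - a' p) (commutator (pauli_op p) B) = 0"
      using pauli_op_commute_supported_on[OF B(1), of p]
      by (cases "supp p \<inter> X = {}") (auto simp: a'_def vec_eq_iff)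
  qed
  finally have "norm (commutator (pauli_sum a) B) = norm (commutator (pauli_sum a') B)" by simp
  also have "\<dots> \<le> 2 * norm (pauli_sum a') * op_norm B" by (rule norm_commutator_le)
  also have "\<dots> \<le> 2 * norm (pauli_sum a') * 1" by (intro mult_left_mono B) auto
  also have "norm (pauli_sum a') = sqrt (real CARD('v \<Rightarrow> 2)) * sqrt (\<Sum>p\<in>UNIV. (cmod (a' p))\<^sup>2)"
    by (rule power2_eq_imp_eq) (simp_all add: norm_pauli_sum power_mult_distrib sum_nonneg)
  also have "(\<Sum>p\<in>UNIV. (cmod (a' p))\<^sup>2) \<le> (\<Sum>x\<in>X. \<Sum>y\<in>-Y. (pair_mass a x y)\<^sup>2)"
  proof -
    have "(cmod (a' p))\<^sup>2 \<le> (\<Sum>x\<in>X. \<Sum>y\<in>-Y. (of_bool (x \<in> supp p \<and> y \<in> supp p) * cmod (a p))\<^sup>2)" for p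
    proof (cases "a' p = 0")
      case False
      then obtain x y where xy: "x \<in> X" "x \<in> supp p" "y \<in> -Y" "y \<in> supp p"
        using a[of p] by (auto simp: a'_def split: if_splits)
      have "(cmod (a' p))\<^sup>2 = (of_bool (x \<in> supp p \<and> y \<in> supp p) * cmod (a p))\<^sup>2"
        using xy by (auto simp: a'_def)
      also have "\<dots> \<le> (\<Sum>y\<in>-Y. (of_bool (x \<in> supp p \<and> y \<in> supp p) * cmod (a p))\<^sup>2)"
        using xy by (intro member_le_sum) auto
      also have "\<dots> \<le> (\<Sum>x\<in>X. \<Sum>y\<in>-Y. (of_bool (x \<in> supp p \<and> y \<in> supp p) * cmod (a p))\<^sup>2)"
        using xy by (intro member_le_sum[of x X "\<lambda>x. \<Sum>y\<in>-Y. (of_bool (x \<in> supp p \<and> y \<in> supp p) * cmod (a p))\<^sup>2"])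
          (auto intro: sum_nonneg)
      finally show ?thesis .
    qed (simp add: sum_nonneg)
    then have "(\<Sum>p\<in>UNIV. (cmod (a' p))\<^sup>2) \<le>
       (\<Sum>p\<in>UNIV. \<Sum>x\<in>X. \<Sum>y\<in>-Y. (of_bool (x \<in> supp p \<and> y \<in> supp p) * cmod (a p))\<^sup>2)"
      by (intro sum_mono)
    also have "\<dots> = (\<Sum>x\<in>X. \<Sum>p\<in>UNIV. \<Sum>y\<in>-Y. (of_bool (x \<in> supp p \<and> y \<in> supp p) * cmod (a p))\<^sup>2)"
      by (rule sum.swap)
    also have "\<dots> = (\<Sum>x\<in>X. \<Sum>y\<in>-Y. \<Sum>p\<in>UNIV. (of_bool (x \<in> supp p \<and> y \<in> supp p) * cmod (a p))\<^sup>2)"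
      by (intro sum.cong refl, rule sum.swap)
    also have "\<dots> \<le> (\<Sum>x\<in>X. \<Sum>y\<in>-Y. (pair_mass a x y)\<^sup>2)"
    proof (intro sum_mono)
      fix x y
      \<comment> \<open>Passing from the square sum to the plain sum over words on one pair: it is
        the plain sum that can be propagated through commutators.\<close>
      have "L2_set (\<lambda>p. of_bool (x \<in> supp p \<and> y \<in> supp p) * cmod (a p)) UNIV \<le> pair_mass a x y"
        unfolding pair_mass_def by (rule L2_set_le_sum) simp
      then show "(\<Sum>p\<in>UNIV. (of_bool (x \<in> supp p \<and> y \<in> supp p) * cmod (a p))\<^sup>2) \<le> (pair_mass a x y)\<^sup>2"
        unfolding L2_set_def by (rule sqrt_le_D)
    qed
    finally show ?thesis .
  qed
  finally show ?thesis by (simp add: mult_left_mono)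
qed

text \<open>Contributing words \<open>q\<close> and \<open>p\<close> meet at some site
  \<open>z\<close>. If \<open>x\<close> lies in \<open>p\<close>, then \<open>q\<close> hits one of
  at most \<open>m\<close> sites, with weight at most \<open>g\<close> at each. If \<open>x\<close>
  lies in \<open>q\<close>, then \<open>q\<close> joins \<open>x\<close> to \<open>z\<close> and
  \<open>p\<close> joins \<open>z\<close> to \<open>y\<close>, a convolution. The factor 2 bounds
  the commutator of two words.\<close>

lemma commutator_coeff_pair_mass:
  fixes a c :: "'v::finite pauli_word \<Rightarrow> complex"
  assumes c: "\<And>q. c q \<noteq> 0 \<Longrightarrow> y \<notin> supp q"
    and g: "\<And>z. pair_mass c z z \<le> g"
    and m: "\<And>p. a p \<noteq> 0 \<Longrightarrow> card (supp p) \<le> m"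
  shows "pair_mass (commutator_coeff c a) x y \<le>
    2 * (g * real m * pair_mass a x y + (\<Sum>z\<in>UNIV. pair_mass c x z * pair_mass a z y))"
proof -
  define I where "I z p = (of_bool (z \<in> supp p) :: real)" for z and p :: "'v pauli_word"
  have I: "0 \<le> I z p" for z p by (simp add: I_def)
  define F where "F q p = 2 * (cmod (c q) * cmod (a p))" for q p
  have F: "0 \<le> F q p" for q p by (simp add: F_def)
  have pm: "pair_mass u v w = (\<Sum>p\<in>UNIV. I v p * I w p * cmod (u p))" for u :: "'v pauli_word \<Rightarrow> complex" and v w
    by (simp add: pair_mass_def I_def of_bool_conj)
  define G where "G x' = (case x' of (q, p) \<Rightarrow>
     of_bool (x \<in> supp (pauli_mult q p) \<and> y \<in> supp (pauli_mult q p) \<and> supp q \<inter> supp p \<noteq> {}) * F q p)" for x'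
  have "pair_mass (commutator_coeff c a) x y \<le> (\<Sum>r\<in>UNIV. \<Sum>x' | x' \<in> UNIV \<and> (case x' of (q, p) \<Rightarrow> pauli_mult q p) = r. G x')"
    unfolding pair_mass_def
  proof (rule sum_mono)
    fix r :: "'v pauli_word"
    have "of_bool (x \<in> supp r \<and> y \<in> supp r) * cmod (commutator_coeff c a r) \<le>
       of_bool (x \<in> supp r \<and> y \<in> supp r) *
       (\<Sum>(q, p) | pauli_mult q p = r \<and> supp q \<inter> supp p \<noteq> {}. 2 * cmod (c q) * cmod (a p))"
      by (intro mult_left_mono norm_commutator_coeff_le) simp
    also have "\<dots> = (\<Sum>x' | (case x' of (q, p) \<Rightarrow> pauli_mult q p) = r \<and> supp (fst x') \<inter> supp (snd x') \<noteq> {}. G x')"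
      unfolding sum_distrib_left by (intro sum.cong) (auto simp: G_def F_def)
    also have "\<dots> = (\<Sum>x' | x' \<in> UNIV \<and> (case x' of (q, p) \<Rightarrow> pauli_mult q p) = r. G x')"
      by (intro sum.mono_neutral_left) (auto simp: G_def)
    finally show "of_bool (x \<in> supp r \<and> y \<in> supp r) * cmod (commutator_coeff c a r) \<le>
      (\<Sum>x' | x' \<in> UNIV \<and> (case x' of (q, p) \<Rightarrow> pauli_mult q p) = r. G x')" .
  qed
  also have "\<dots> = sum G UNIV" by (rule sum.group) auto
  also have "\<dots> \<le> (\<Sum>(q, p)\<in>UNIV. (\<Sum>z\<in>UNIV. I x p * I y p * I z p * I z q * F q p)
      + (\<Sum>z\<in>UNIV. I x q * I z q * I z p * I y p * F q p))"
  proof (rule sum_mono, clarify)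
    fix q p :: "'v pauli_word"
    let ?S1 = "\<Sum>z\<in>UNIV. I x p * I y p * I z p * I z q * F q p"
    let ?S2 = "\<Sum>z\<in>UNIV. I x q * I z q * I z p * I y p * F q p"
    have nn: "0 \<le> ?S1" "0 \<le> ?S2" by (auto intro!: sum_nonneg mult_nonneg_nonneg simp: I F)
    show "G (q, p) \<le> ?S1 + ?S2"
    proof (cases "c q \<noteq> 0 \<and> x \<in> supp (pauli_mult q p) \<and> y \<in> supp (pauli_mult q p) \<and> supp q \<inter> supp p \<noteq> {}")
      case False
      then have "G (q, p) = 0" by (auto simp: G_def F_def)
      then show ?thesis using nn by simp
    next
      case True
      then obtain z where z: "z \<in> supp q" "z \<in> supp p" by blast
      \<comment> \<open>The endpoint \<open>y\<close> can only stem from \<open>p\<close>, since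
        \<open>q\<close> does not contain it; so there is no term in which \<open>y\<close>
        moves.\<close>
      have y: "y \<in> supp p" using True c[of q] supp_pauli_mult_outside[of y q p] by blast
      have G: "G (q, p) = F q p" using True by (simp add: G_def)
      have "x \<in> supp p \<or> x \<in> supp q" using True supp_pauli_mult[of q p] by blast
      then show ?thesis
      proof
        assume "x \<in> supp p"
        then have "F q p = I x p * I y p * I z p * I z q * F q p" using y z by (simp add: I_def)
        also have "\<dots> \<le> ?S1" by (rule member_le_sum) (auto simp: I F)
        finally show ?thesis using nn G by simp
      next
        assume "x \<in> supp q"
        then have "F q p = I x q * I z q * I z p * I y p * F q p" using y z by (simp add: I_def)
        also have "\<dots> \<le> ?S2" by (rule member_le_sum) (auto simp: I F)
        finally show ?thesis using nn G by simp
      qed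
    qed
  qed
  also have "\<dots> = (\<Sum>q\<in>UNIV. \<Sum>p\<in>UNIV. \<Sum>z\<in>UNIV. I x p * I y p * I z p * I z q * F q p)
      + (\<Sum>q\<in>UNIV. \<Sum>p\<in>UNIV. \<Sum>z\<in>UNIV. I x q * I z q * I z p * I y p * F q p)"
    unfolding UNIV_Times_UNIV[symmetric] sum.cartesian_product[symmetric] by (simp add: sum.distrib)
  also have "(\<Sum>q\<in>UNIV. \<Sum>p\<in>UNIV. \<Sum>z\<in>UNIV. I x p * I y p * I z p * I z q * F q p)
      = (\<Sum>p\<in>UNIV. \<Sum>z\<in>UNIV. \<Sum>q\<in>UNIV. I x p * I y p * I z p * I z q * F q p)"
    by (subst sum.swap, intro sum.cong refl, rule sum.swap)
  also have "\<dots> = (\<Sum>p\<in>UNIV. I x p * I y p * cmod (a p) * (\<Sum>z\<in>UNIV. I z p * (2 * pair_mass c z z)))"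
    unfolding pm sum_distrib_left
    by (intro sum.cong refl) (simp add: F_def I_def)
  also have "\<dots> \<le> (\<Sum>p\<in>UNIV. I x p * I y p * cmod (a p) * (2 * (g * real m)))"
  proof (intro sum_mono)
    fix p :: "'v pauli_word"
    show "I x p * I y p * cmod (a p) * (\<Sum>z\<in>UNIV. I z p * (2 * pair_mass c z z))
       \<le> I x p * I y p * cmod (a p) * (2 * (g * real m))"
    proof (cases "a p = 0")
      case False
      have "0 \<le> g" using g[of x] pair_mass_nonneg[of c x x] by linarith
      have "(\<Sum>z\<in>UNIV. I z p * (2 * pair_mass c z z)) \<le> (\<Sum>z\<in>UNIV. I z p * (2 * g))"
        by (intro sum_mono mult_left_mono) (auto simp: I g)
      also have "\<dots> = real (card (supp p)) * (2 * g)"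
        unfolding sum_distrib_right[symmetric] I_def by (simp add: sum_of_bool_eq)
      also have "\<dots> \<le> real m * (2 * g)"
        using m[OF False] \<open>0 \<le> g\<close> by (intro mult_right_mono) auto
      finally show ?thesis by (intro mult_left_mono) (auto simp: I mult_ac)
    qed simp
  qed
  also have "\<dots> = 2 * (g * real m) * pair_mass a x y"
    by (simp add: pm sum_distrib_left mult_ac)
  also have "(\<Sum>q\<in>UNIV. \<Sum>p\<in>UNIV. \<Sum>z\<in>UNIV. I x q * I z q * I z p * I y p * F q p)
      = (\<Sum>z\<in>UNIV. \<Sum>q\<in>UNIV. \<Sum>p\<in>UNIV. I x q * I z q * I z p * I y p * F q p)"
  proof -
    have "(\<Sum>q\<in>UNIV. \<Sum>p\<in>UNIV. \<Sum>z\<in>UNIV. I x q * I z q * I z p * I y p * F q p)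
      = (\<Sum>q\<in>UNIV. \<Sum>z\<in>UNIV. \<Sum>p\<in>UNIV. I x q * I z q * I z p * I y p * F q p)"
      by (intro sum.cong refl, rule sum.swap)
    also have "\<dots> = (\<Sum>z\<in>UNIV. \<Sum>q\<in>UNIV. \<Sum>p\<in>UNIV. I x q * I z q * I z p * I y p * F q p)"
      by (rule sum.swap)
    finally show ?thesis .
  qed
  also have "\<dots> = 2 * (\<Sum>z\<in>UNIV. pair_mass c x z * pair_mass a z y)"
    unfolding pm unfolding sum_product unfolding sum_distrib_left
    by (intro sum.cong refl) (simp add: F_def mult_ac)
  finally show ?thesis by (simp add: algebra_simps)
qed

text \<open>Its limit 4 is half of the constant 8 in the commutator bound below.\<close>

lemma sum_Suc_half_powers: "(\<Sum>n<N. real (Suc n) * (1 / 2) ^ n) = 4 - (2 * real N + 4) / 2 ^ N"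
proof (induction N)
  case (Suc N)
  show ?case unfolding sum.lessThan_Suc Suc by (simp add: field_simps)
qed simp

text \<open>
  Each commutator with an interaction term inside \<open>Y\<close> either hits the word somewhere (rate \<open>g\<close>
  times its size) or moves the endpoint \<open>x\<close> (rate \<open>lam J\<close> by the convolution property of \<open>w\<close>);
  the endpoint \<open>y\<close> outside \<open>Y\<close> is never touched.
\<close>

lemma iterated_commutator_pair_mass:
  fixes a0 c :: "'v::finite pauli_word \<Rightarrow> complex"
  assumes c_supp: "\<And>q. c q \<noteq> 0 \<Longrightarrow> supp q \<subseteq> Y"
    and c_card: "\<And>q. c q \<noteq> 0 \<Longrightarrow> card (supp q) \<le> k"
    and c_g: "\<And>z. pair_mass c z z \<le> g"
    and c_J: "\<And>x y. pair_mass c x y \<le> J * w x y"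
    and a0_supp: "\<And>p. a0 p \<noteq> 0 \<Longrightarrow> \<not> supp p \<subseteq> Y"
    and a0_card: "\<And>p. a0 p \<noteq> 0 \<Longrightarrow> card (supp p) \<le> k"
    and a0_J: "\<And>x y. pair_mass a0 x y \<le> J * w x y"
    and w: "\<And>x y. 0 \<le> w x y" "\<And>x y. (\<Sum>z\<in>UNIV. w x z * w z y) \<le> lam * w x y"
    and J: "0 \<le> J" and gt: "g * real k \<le> gt" "lam * J \<le> gt"
  shows "((commutator_coeff c ^^ n) a0 p \<noteq> 0 \<longrightarrow> \<not> supp p \<subseteq> Y \<and> card (supp p) \<le> k * Suc n) \<and>
    (\<forall>x. \<forall>y\<in>-Y. pair_mass ((commutator_coeff c ^^ n) a0) x y \<le> (2 * gt) ^ n * fact (Suc n) * (J * w x y))"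
proof (induction n arbitrary: p)
  case 0
  then show ?case using a0_supp a0_card a0_J by simp
next
  case (Suc n)
  let ?a = "(commutator_coeff c ^^ n) a0"
  have a: "?a p \<noteq> 0 \<Longrightarrow> \<not> supp p \<subseteq> Y" "?a p \<noteq> 0 \<Longrightarrow> card (supp p) \<le> k * Suc n" for p
    using Suc by blast+
  have mass: "pair_mass ?a x y \<le> (2 * gt) ^ n * fact (Suc n) * (J * w x y)" if "y \<notin> Y" for x y
    using Suc that by blast
  define K where "K = (2 * gt) ^ n * fact (Suc n) * J"
  have "0 \<le> g" using c_g[of undefined] pair_mass_nonneg[of c undefined undefined] by linarith
  then have gt0: "0 \<le> gt" using gt(1) by (meson mult_nonneg_nonneg of_nat_0_le_iff order_trans)
  then have K: "0 \<le> K" using J by (simp add: K_def)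
  show ?case
  proof (intro conjI impI allI ballI)
    assume "(commutator_coeff c ^^ Suc n) a0 p \<noteq> 0"
    then have "commutator_coeff c ?a p \<noteq> 0" by simp
    then obtain q p' where qp: "pauli_mult q p' = p" "c q \<noteq> 0" "?a p' \<noteq> 0"
      unfolding commutator_coeff_def by (auto elim!: sum.not_neutral_contains_not_neutral)
    obtain y where y: "y \<in> supp p'" "y \<notin> Y" using a(1)[OF qp(3)] by blast
    then have "y \<in> supp p" using qp c_supp[OF qp(2)] supp_pauli_mult_outside[of y q p'] by blast
    with y show "\<not> supp p \<subseteq> Y" by blast
    have "card (supp p) \<le> card (supp q \<union> supp p')"
      using supp_pauli_mult[of q p'] qp(1) by (intro card_mono) auto
    also have "\<dots> \<le> card (supp q) + card (supp p')" by (rule card_Un_le)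
    also have "\<dots> \<le> k + k * Suc n" using c_card[OF qp(2)] a(2)[OF qp(3)] by linarith
    finally show "card (supp p) \<le> k * Suc (Suc n)" by simp
  next
    fix x y assume y: "y \<in> -Y"
    have "pair_mass (commutator_coeff c ?a) x y \<le> 2 * (g * real (k * Suc n) * pair_mass ?a x y
        + (\<Sum>z\<in>UNIV. pair_mass c x z * pair_mass ?a z y))"
      using y c_supp by (intro commutator_coeff_pair_mass c_g a) auto
    also have "g * real (k * Suc n) * pair_mass ?a x y \<le> (gt * real (Suc n)) * (K * w x y)"
    proof (rule mult_mono)
      have "g * real (k * Suc n) = (g * real k) * real (Suc n)" by (simp add: algebra_simps)
      also have "\<dots> \<le> gt * real (Suc n)" by (intro mult_right_mono gt) simp
      finally show "g * real (k * Suc n) \<le> gt * real (Suc n)" .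
      show "pair_mass ?a x y \<le> K * w x y" using mass[of y x] y by (simp add: K_def mult_ac)
    qed (use gt0 in \<open>auto simp: pair_mass_nonneg\<close>)
    also have "(\<Sum>z\<in>UNIV. pair_mass c x z * pair_mass ?a z y) \<le> (\<Sum>z\<in>UNIV. (J * w x z) * (K * w z y))"
    proof (intro sum_mono mult_mono c_J)
      fix z
      show "pair_mass ?a z y \<le> K * w z y" using mass[of y z] y by (simp add: K_def mult_ac)
    qed (auto simp: pair_mass_nonneg J w)
    also have "\<dots> = J * K * (\<Sum>z\<in>UNIV. w x z * w z y)" by (simp add: sum_distrib_left mult_ac)
    also have "\<dots> \<le> J * K * (lam * w x y)" by (intro mult_left_mono w) (simp add: J K)
    also have "\<dots> = (lam * J) * (K * w x y)" by simp
    also have "\<dots> \<le> gt * (K * w x y)" by (intro mult_right_mono gt) (simp add: K w)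
    finally have "pair_mass (commutator_coeff c ?a) x y \<le> 2 * (gt * real (Suc n) * (K * w x y) + gt * (K * w x y))"
      by simp
    \<comment> \<open>Hitting the word costs \<open>gt * Suc n\<close> and moving its endpoint costs
      \<open>gt\<close>; together \<open>gt * (n + 2)\<close>, the next factor of the
      factorial.\<close>
    also have "\<dots> = (2 * gt) ^ Suc n * fact (Suc (Suc n)) * (J * w x y)"
      by (simp add: K_def algebra_simps)
    finally show "pair_mass ((commutator_coeff c ^^ Suc n) a0) x y \<le> (2 * gt) ^ Suc n * fact (Suc (Suc n)) * (J * w x y)"
      by simp
  qed
qed

lemma commutator_pauli_sum_funpow:
  "(commutator (pauli_sum c) ^^ n) (pauli_sum a) = pauli_sum ((commutator_coeff c ^^ n) a)"
  by (induction n) (simp_all add: commutator_pauli_sum)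

text \<open>Taylor's \<open>1 / fact n\<close> cancels the factorial growth of the weights up to the
  factor \<open>Suc n\<close>, and \<open>2 * gt * s \<le> 1 / 2\<close> makes the remaining series
  summable.\<close>

lemma norm_commutator_heis_pauli_sum_le:
  fixes a0 c :: "'v::finite pauli_word \<Rightarrow> complex"
  assumes c_supp: "\<And>q. c q \<noteq> 0 \<Longrightarrow> supp q \<subseteq> Y"
    and c_card: "\<And>q. c q \<noteq> 0 \<Longrightarrow> card (supp q) \<le> k"
    and c_g: "\<And>z. pair_mass c z z \<le> g"
    and c_J: "\<And>x y. pair_mass c x y \<le> J * w x y"
    and a0_supp: "\<And>p. a0 p \<noteq> 0 \<Longrightarrow> \<not> supp p \<subseteq> Y"
    and a0_card: "\<And>p. a0 p \<noteq> 0 \<Longrightarrow> card (supp p) \<le> k"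
    and a0_J: "\<And>x y. pair_mass a0 x y \<le> J * w x y"
    and w: "\<And>x y. 0 \<le> w x y" "\<And>x y. (\<Sum>z\<in>UNIV. w x z * w z y) \<le> lam * w x y"
    and J: "0 \<le> J" and gt: "g * real k \<le> gt" "lam * J \<le> gt"
    and ah: "antihermitian (pauli_sum c)" and s: "0 \<le> s" "2 * gt * s \<le> 1 / 2"
    and B: "supported_on X B" "op_norm B \<le> 1"
  shows "norm (commutator (heis (pauli_sum c) s (pauli_sum a0)) B)
    \<le> 8 * (sqrt (real CARD('v \<Rightarrow> 2)) * (J * sqrt (\<Sum>x\<in>X. \<Sum>y\<in>-Y. (w x y)\<^sup>2)))"
proof (rule norm_commutator_heis_le[OF ah s(1)])
  fix N
  define S where "S = sqrt (real CARD('v \<Rightarrow> 2)) * (J * sqrt (\<Sum>x\<in>X. \<Sum>y\<in>-Y. (w x y)\<^sup>2))"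
  have "0 \<le> (\<Sum>x\<in>X. \<Sum>y\<in>-Y. (w x y)\<^sup>2)" by (intro sum_nonneg) simp
  then have S: "0 \<le> S" using J by (simp add: S_def)
  have "0 \<le> g" using c_g[of undefined] pair_mass_nonneg[of c undefined undefined] by linarith
  then have gt0: "0 \<le> gt" using gt(1) by (meson mult_nonneg_nonneg of_nat_0_le_iff order_trans)
  note mass = iterated_commutator_pair_mass[OF c_supp c_card c_g c_J a0_supp a0_card a0_J w J gt]
  have "s ^ n / fact n * norm (commutator ((commutator (pauli_sum c) ^^ n) (pauli_sum a0)) B)
     \<le> 2 * S * (real (Suc n) * (1 / 2) ^ n)" for n
  proof -
    let ?a = "(commutator_coeff c ^^ n) a0"
    let ?K = "(2 * gt) ^ n * fact (Suc n)"
    have K: "0 \<le> ?K" using gt0 by simp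
    have "(\<Sum>x\<in>X. \<Sum>y\<in>-Y. (pair_mass ?a x y)\<^sup>2) \<le> (\<Sum>x\<in>X. \<Sum>y\<in>-Y. (?K * (J * w x y))\<^sup>2)"
      using mass by (intro sum_mono power_mono) (auto simp: pair_mass_nonneg)
    also have "\<dots> = (?K * J)\<^sup>2 * (\<Sum>x\<in>X. \<Sum>y\<in>-Y. (w x y)\<^sup>2)"
      by (simp add: sum_distrib_left power_mult_distrib mult_ac)
    finally have "sqrt (\<Sum>x\<in>X. \<Sum>y\<in>-Y. (pair_mass ?a x y)\<^sup>2)
        \<le> sqrt ((?K * J)\<^sup>2 * (\<Sum>x\<in>X. \<Sum>y\<in>-Y. (w x y)\<^sup>2))"
      by (rule real_sqrt_le_mono)
    also have "\<dots> = ?K * J * sqrt (\<Sum>x\<in>X. \<Sum>y\<in>-Y. (w x y)\<^sup>2)"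
      using K J by (simp only: real_sqrt_mult real_sqrt_abs abs_of_nonneg mult_nonneg_nonneg)
    finally have root: "sqrt (\<Sum>x\<in>X. \<Sum>y\<in>-Y. (pair_mass ?a x y)\<^sup>2)
        \<le> ?K * J * sqrt (\<Sum>x\<in>X. \<Sum>y\<in>-Y. (w x y)\<^sup>2)" .
    have "norm (commutator (pauli_sum ?a) B)
        \<le> 2 * (sqrt (real CARD('v \<Rightarrow> 2)) * sqrt (\<Sum>x\<in>X. \<Sum>y\<in>-Y. (pair_mass ?a x y)\<^sup>2))"
      using mass by (intro norm_commutator_pauli_sum_le B) blast
    also have "\<dots> \<le> 2 * (sqrt (real CARD('v \<Rightarrow> 2)) * (?K * J * sqrt (\<Sum>x\<in>X. \<Sum>y\<in>-Y. (w x y)\<^sup>2)))"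
      by (intro mult_left_mono root) simp_all
    also have "\<dots> = 2 * (?K * S)"
      by (simp only: S_def mult_ac)
    finally have "norm (commutator (pauli_sum ?a) B) \<le> 2 * (?K * S)" .
    then have "s ^ n / fact n * norm (commutator (pauli_sum ?a) B) \<le> s ^ n / fact n * (2 * (?K * S))"
      using s by (intro mult_left_mono) auto
    also have "\<dots> = 2 * S * (real (Suc n) * (2 * gt * s) ^ n)"
      by (simp add: power_mult_distrib fact_Suc mult_ac del: of_nat_Suc)
    also have "\<dots> \<le> 2 * S * (real (Suc n) * (1 / 2) ^ n)"
      using S s gt0 by (intro mult_left_mono power_mono) auto
    finally show ?thesis by (simp add: commutator_pauli_sum_funpow)
  qed
  then have "(\<Sum>n<N. s ^ n / fact n * norm (commutator ((commutator (pauli_sum c) ^^ n) (pauli_sum a0)) B))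
     \<le> 2 * S * (\<Sum>n<N. real (Suc n) * (1 / 2) ^ n)"
    unfolding sum_distrib_left by (intro sum_mono)
  also have "\<dots> \<le> 2 * S * 4"
    unfolding sum_Suc_half_powers using S by (intro mult_left_mono) auto
  finally show "(\<Sum>n<N. s ^ n / fact n * norm (commutator ((commutator (pauli_sum c) ^^ n) (pauli_sum a0)) B))
     \<le> 8 * (sqrt (real CARD('v \<Rightarrow> 2)) * (J * sqrt (\<Sum>x\<in>X. \<Sum>y\<in>-Y. (w x y)\<^sup>2)))"
    by (simp add: S_def)
qed

section \<open>Pairs of sites across a shell\<close>

lemma gdist_relpow:
  assumes "connected_graph E"
  shows "(x, y) \<in> E ^^ gdist E x y"
proof -
  have "(x, y) \<in> E\<^sup>*" using assms by (simp add: connected_graph_def)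
  then have "\<exists>n. (x, y) \<in> E ^^ n" by (simp add: rtrancl_power)
  then show ?thesis unfolding gdist_def by (rule LeastI_ex)
qed

lemma gdist_le: "(x, y) \<in> E ^^ n \<Longrightarrow> gdist E x y \<le> n"
  unfolding gdist_def by (rule Least_le)

lemma gdist_triangle:
  assumes "connected_graph E"
  shows "gdist E x z \<le> gdist E x y + gdist E y z"
  using gdist_relpow[OF assms, of x y] gdist_relpow[OF assms, of y z]
  by (intro gdist_le) (auto simp: relpow_add)

lemma gdist_self [simp]: "gdist E x x = 0"
  using gdist_le[of x x 0 E] by simp

lemma gdist_eq_0_iff:
  assumes "connected_graph E"
  shows "gdist E x y = 0 \<longleftrightarrow> x = y"
  using gdist_relpow[OF assms, of x y] by auto

text \<open>Integral comparison in telescoping form, by the mean value theorem; summing it bounds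
  the tails of power series in the distance.\<close>

lemma powr_neg_le_diff:
  assumes \<beta>: "\<beta> > 1" and d: "d \<ge> (1::real)"
  shows "(d + 1) powr - \<beta> \<le> (d powr (1 - \<beta>) - (d + 1) powr (1 - \<beta>)) / (\<beta> - 1)"
proof -
  have "\<exists>z>d. z < d + 1 \<and> (d + 1) powr (1 - \<beta>) - d powr (1 - \<beta>) = (d + 1 - d) * ((1 - \<beta>) * z powr (1 - \<beta> - 1))"
    by (rule MVT2) (use d in \<open>auto intro!: derivative_eq_intros simp: field_simps\<close>)
  then obtain z where z: "d < z" "z < d + 1"
    and eq: "(d + 1) powr (1 - \<beta>) - d powr (1 - \<beta>) = (1 - \<beta>) * z powr - \<beta>"
    by auto
  have "(d + 1) powr - \<beta> \<le> z powr - \<beta>"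
    using z d \<beta> by (intro powr_mono2') auto
  then have "(\<beta> - 1) * (d + 1) powr - \<beta> \<le> (\<beta> - 1) * z powr - \<beta>"
    using \<beta> by (intro mult_left_mono) auto
  also have "\<dots> = d powr (1 - \<beta>) - (d + 1) powr (1 - \<beta>)" using eq by (simp add: algebra_simps)
  finally show ?thesis using \<beta> by (simp add: field_simps)
qed

lemma sum_powr_tail_le:
  assumes \<beta>: "\<beta> > 1" and q: "q \<ge> (1::nat)"
  shows "(\<Sum>d=q..N. (real d + 1) powr - \<beta>) \<le> real q powr (1 - \<beta>) / (\<beta> - 1)"
proof (cases "q \<le> N")
  case True
  have "(\<Sum>d=q..N. (real d + 1) powr - \<beta>)
      \<le> (\<Sum>d=q..N. (real d powr (1 - \<beta>) - real (Suc d) powr (1 - \<beta>)) / (\<beta> - 1))"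
  proof (rule sum_mono)
    fix d assume "d \<in> {q..N}"
    then have "1 \<le> real d" using q by auto
    from powr_neg_le_diff[OF \<beta> this]
    show "(real d + 1) powr - \<beta> \<le> (real d powr (1 - \<beta>) - real (Suc d) powr (1 - \<beta>)) / (\<beta> - 1)"
      by (simp add: add.commute)
  qed
  also have "\<dots> = (real q powr (1 - \<beta>) - real (Suc N) powr (1 - \<beta>)) / (\<beta> - 1)"
    using sum_Suc_diff[of q "Suc N" "\<lambda>d. - (real d powr (1 - \<beta>))"] True
    by (simp add: atLeastLessThanSuc_atLeastAtMost sum_Suc_diff' flip: sum_divide_distrib)
  also have "\<dots> \<le> real q powr (1 - \<beta>) / (\<beta> - 1)"
    using \<beta> by (intro divide_right_mono) auto
  finally show ?thesis .
qed (use \<beta> in auto)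

lemma sum_by_distance:
  fixes f :: "nat \<Rightarrow> real" and E :: "('v::finite \<times> 'v) set"
  assumes f: "\<And>d. 0 \<le> f d" and c: "\<And>d. q \<le> d \<Longrightarrow> d \<le> N \<Longrightarrow> real (card (gsphere E x d)) \<le> c d"
    and S: "\<And>y. y \<in> S \<Longrightarrow> q \<le> gdist E x y \<and> gdist E x y \<le> N"
  shows "(\<Sum>y\<in>S. f (gdist E x y)) \<le> (\<Sum>d=q..N. c d * f d)"
proof -
  have "(\<Sum>y\<in>S. f (gdist E x y)) = (\<Sum>d=q..N. \<Sum>y | y \<in> S \<and> gdist E x y = d. f (gdist E x y))"
    using S by (intro sum.group[symmetric]) auto
  also have "\<dots> \<le> (\<Sum>d=q..N. c d * f d)"
  proof (rule sum_mono)
    fix d assume d: "d \<in> {q..N}"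
    have "(\<Sum>y | y \<in> S \<and> gdist E x y = d. f (gdist E x y)) \<le> (\<Sum>y\<in>gsphere E x d. f (gdist E x y))"
      by (intro sum_mono2) (auto simp: gsphere_def f)
    also have "\<dots> = real (card (gsphere E x d)) * f d"
      by (simp add: gsphere_def)
    also have "\<dots> \<le> c d * f d" using c d f by (intro mult_right_mono) auto
    finally show "(\<Sum>y | y \<in> S \<and> gdist E x y = d. f (gdist E x y)) \<le> c d * f d" .
  qed
  finally show ?thesis .
qed

text \<open>Distances are resolved twice: of \<open>y\<close> from \<open>x\<close>, then of
  \<open>x\<close> from \<open>i\<close>. The inner sum decays with the distance of \<open>x\<close>
  to the outer boundary, so the sites near that boundary dominate; hence the radius enters with
  power \<open>D - 1\<close> and not \<open>D\<close>.\<close>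

lemma sum_crossing_le:
  fixes E :: "('v::finite \<times> 'v) set" and D L r :: nat and \<alpha> \<gamma> :: real
  assumes graph: "connected_graph E" and D: "D \<ge> 1" and gamma: "\<gamma> \<ge> 1"
    and sphere: "\<And>j r. r \<ge> 1 \<Longrightarrow> real (card (gsphere E j r)) \<le> \<gamma> * real r ^ (D - 1)"
    and alpha: "\<alpha> > real D" and L: "L \<ge> 1"
  shows "(\<Sum>x\<in>gball E i r. \<Sum>y\<in>- gball E i (r + L). ((real (gdist E x y) + 1) powr (- \<alpha>))\<^sup>2)
    \<le> \<gamma>\<^sup>2 * real (r + L) ^ (D - 1) * real L powr (1 + real D - 2 * \<alpha>)
        / ((2 * \<alpha> - real D) * (2 * \<alpha> - real D - 1))"
proof -
  \<comment> \<open>The sphere size adds \<open>D - 1\<close> to the squared decay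
    \<open>- 2 * \<alpha>\<close>, which gives \<open>- \<beta>\<close>. Each tail sum costs one
    power, and \<open>\<beta> > 2\<close> lets both converge.\<close>
  define \<beta> where "\<beta> = 2 * \<alpha> - real D + 1"
  have \<beta>: "\<beta> > 2" using alpha D by (simp add: \<beta>_def)
  obtain N where N: "\<And>x y. gdist E x y \<le> N"
  proof -
    have "gdist E x y \<le> Max (range (case_prod (gdist E)))" for x y
      by (intro Max_ge) (auto intro: image_eqI[of _ _ "(x, y)"])
    then show ?thesis using that by blast
  qed
  have inner: "(\<Sum>y\<in>- gball E i (r + L). ((real (gdist E x y) + 1) powr (- \<alpha>))\<^sup>2)
      \<le> \<gamma> * ((real (r + L - gdist E i x) + 1) powr (1 - \<beta>) / (\<beta> - 1))" if x: "gdist E i x \<le> r" for x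
  proof -
    \<comment> \<open>Sites outside the larger ball have distance at least \<open>r + L + 1\<close>
      from \<open>i\<close>, so by the triangle inequality at least \<open>q\<close> from
      \<open>x\<close>.\<close>
    define q where "q = r + L + 1 - gdist E i x"
    have q: "q \<ge> 1" and rq: "real q = real (r + L - gdist E i x) + 1" using x L by (auto simp: q_def)
    have "(\<Sum>y\<in>- gball E i (r + L). ((real (gdist E x y) + 1) powr (- \<alpha>))\<^sup>2)
       = (\<Sum>y\<in>- gball E i (r + L). (real (gdist E x y) + 1) powr (- 2 * \<alpha>))"
      by (simp add: powr_powr mult.commute flip: powr_numeral)
    also have "\<dots> \<le> (\<Sum>d=q..N. (\<gamma> * real d ^ (D - 1)) * (real d + 1) powr (- 2 * \<alpha>))"
    proof (rule sum_by_distance[where f = "\<lambda>d. (real d + 1) powr (- 2 * \<alpha>)"])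
      fix y assume "y \<in> - gball E i (r + L)"
      then have "r + L < gdist E i y" by (simp add: gball_def)
      then show "q \<le> gdist E x y \<and> gdist E x y \<le> N"
        using gdist_triangle[OF graph, of i y x] N unfolding q_def by (auto intro: le_trans)
    qed (use q sphere in auto)
    also have "\<dots> \<le> (\<Sum>d=q..N. \<gamma> * (real d + 1) powr - \<beta>)"
    proof (rule sum_mono)
      fix d assume "d \<in> {q..N}"
      have "real d ^ (D - 1) * (real d + 1) powr (- 2 * \<alpha>) \<le> (real d + 1) ^ (D - 1) * (real d + 1) powr (- 2 * \<alpha>)"
        by (intro mult_right_mono power_mono) auto
      also have "\<dots> = (real d + 1) powr (real (D - 1) + - 2 * \<alpha>)"
        by (subst powr_add, subst powr_realpow) auto
      also have "real (D - 1) + - 2 * \<alpha> = - \<beta>" using D by (simp add: \<beta>_def of_nat_diff)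
      finally show "\<gamma> * real d ^ (D - 1) * (real d + 1) powr (- 2 * \<alpha>) \<le> \<gamma> * (real d + 1) powr - \<beta>"
        using gamma by (simp add: mult.assoc)
    qed
    also have "\<dots> = \<gamma> * (\<Sum>d=q..N. (real d + 1) powr - \<beta>)" by (simp add: sum_distrib_left)
    also have "\<dots> \<le> \<gamma> * (real q powr (1 - \<beta>) / (\<beta> - 1))"
      using gamma \<beta> q by (intro mult_left_mono sum_powr_tail_le) auto
    finally show ?thesis by (simp add: rq)
  qed
  \<comment> \<open>One bound for all spheres about \<open>i\<close> of radius at most
    \<open>r\<close>, the single point at radius 0 included.\<close>
  define c where "c = \<gamma> * real (r + L) ^ (D - 1)"
  have c: "0 \<le> c" using gamma by (simp add: c_def)
  have "(\<Sum>x\<in>gball E i r. \<Sum>y\<in>- gball E i (r + L). ((real (gdist E x y) + 1) powr (- \<alpha>))\<^sup>2)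
    \<le> (\<Sum>x\<in>gball E i r. \<gamma> * ((real (r + L - gdist E i x) + 1) powr (1 - \<beta>) / (\<beta> - 1)))"
    using inner by (intro sum_mono) (auto simp: gball_def)
  also have "\<dots> \<le> (\<Sum>d=0..r. c * (\<gamma> * ((real (r + L - d) + 1) powr (1 - \<beta>) / (\<beta> - 1))))"
  proof (rule sum_by_distance[where f = "\<lambda>d. \<gamma> * ((real (r + L - d) + 1) powr (1 - \<beta>) / (\<beta> - 1))"])
    show "real (card (gsphere E i d)) \<le> c" if "d \<le> r" for d
    proof (cases "d = 0")
      case True
      then have "gsphere E i d = {i}" by (auto simp: gsphere_def gdist_eq_0_iff[OF graph])
      moreover have "1 * 1 \<le> c" unfolding c_def
        using gamma L by (intro mult_mono one_le_power) auto
      ultimately show ?thesis by simp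
    next
      case False
      then have "real (card (gsphere E i d)) \<le> \<gamma> * real d ^ (D - 1)" by (intro sphere) simp
      also have "\<dots> \<le> c" unfolding c_def
        using gamma that by (intro mult_left_mono power_mono) auto
      finally show ?thesis .
    qed
  qed (use gamma \<beta> in \<open>auto simp: gball_def\<close>)
  also have "\<dots> = c * (\<gamma> * ((\<Sum>d=0..r. (real (r + L - d) + 1) powr (1 - \<beta>)) / (\<beta> - 1)))"
    by (simp add: sum_distrib_left sum_divide_distrib)
  \<comment> \<open>Counting shells by their depth below the outer radius produces a second tail
    sum, which starts at \<open>L\<close>.\<close>
  also have "(\<Sum>d=0..r. (real (r + L - d) + 1) powr (1 - \<beta>)) = (\<Sum>d=L..r + L. (real d + 1) powr - (\<beta> - 1))"
    by (rule sum.reindex_bij_witness[of _ "\<lambda>d. r + L - d" "\<lambda>d. r + L - d"]) auto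
  also have "c * (\<gamma> * (\<dots> / (\<beta> - 1))) \<le> c * (\<gamma> * (real L powr (1 - (\<beta> - 1)) / (\<beta> - 1 - 1) / (\<beta> - 1)))"
    using c gamma \<beta> L by (intro mult_left_mono divide_right_mono sum_powr_tail_le) auto
  also have "\<dots> = \<gamma>\<^sup>2 * real (r + L) ^ (D - 1) * real L powr (1 + real D - 2 * \<alpha>)
        / ((2 * \<alpha> - real D) * (2 * \<alpha> - real D - 1))"
    by (simp add: c_def \<beta>_def power2_eq_square algebra_simps)
  finally show ?thesis .
qed

section \<open>Interaction terms as Pauli sums\<close>

definition word_of :: "'v set \<Rightarrow> ('v \<Rightarrow> pauli) \<Rightarrow> 'v pauli_word" where
  "word_of Z q = (\<lambda>v. if v \<in> Z then Some (q v) else None)"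

text \<open>Restricted so as to lie in the extensional function space \<open>pauli_labels\<close>;
  this makes it inverse to \<open>word_of\<close>.\<close>

definition label_of :: "'v pauli_word \<Rightarrow> 'v \<Rightarrow> pauli" where
  "label_of p = restrict (\<lambda>v. the (p v)) (supp p)"

lemma supp_word_of [simp]: "supp (word_of Z q) = Z"
  by (auto simp: supp_def word_of_def)

lemma label_of_word_of: "q \<in> pauli_labels Z \<Longrightarrow> label_of (word_of Z q) = q"
  by (auto simp: label_of_def pauli_labels_def PiE_def extensional_def restrict_def fun_eq_iff)
    (simp add: word_of_def)

lemma word_of_label_of: "word_of (supp p) (label_of p) = p"
  by (auto simp: word_of_def label_of_def supp_def fun_eq_iff)

lemma label_of_in [simp]: "label_of p \<in> pauli_labels (supp p)"
  by (simp add: label_of_def pauli_labels_def)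

lemma finite_pauli_labels [simp]: "finite (pauli_labels (Z :: 'v::finite set))"
  unfolding pauli_labels_def by (intro finite_PiE) auto

lemma card_pauli_labels: "card (pauli_labels (Z :: 'v::finite set)) = 3 ^ card Z"
proof -
  have "card (UNIV :: pauli set) = 3" by (simp add: UNIV_pauli)
  then show ?thesis by (simp add: pauli_labels_def card_PiE)
qed

lemma pauli_string_eq_pauli_op: "pauli_string Z q = pauli_op (word_of Z q)"
proof -
  have "(if v \<in> Z then pauli_mat (q v) else mat 1) = pauli1 (word_of Z q v)" for v
    by (simp add: word_of_def)
  then show ?thesis by (simp add: pauli_string_def pauli_op_def)
qed

lemma sum_pauli_labels:
  fixes f :: "'v::finite set \<Rightarrow> ('v \<Rightarrow> pauli) \<Rightarrow> 'b::comm_monoid_add"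
  shows "(\<Sum>Z\<in>\<Z>. \<Sum>q\<in>pauli_labels Z. f Z q) = (\<Sum>p | supp p \<in> \<Z>. f (supp p) (label_of p))"
proof -
  have "(\<Sum>Z\<in>\<Z>. \<Sum>q\<in>pauli_labels Z. f Z q) = (\<Sum>(Z, q)\<in>Sigma \<Z> pauli_labels. f Z q)"
    by (rule sum.Sigma) auto
  also have "\<dots> = (\<Sum>p | supp p \<in> \<Z>. f (supp p) (label_of p))"
    by (rule sum.reindex_bij_witness[of _ "\<lambda>p. (supp p, label_of p)" "\<lambda>(Z, q). word_of Z q"])
      (auto simp: label_of_word_of word_of_label_of)
  finally show ?thesis .
qed

definition coupling :: "nat \<Rightarrow> ('v set \<Rightarrow> ('v \<Rightarrow> pauli) \<Rightarrow> complex) \<Rightarrow> 'v pauli_word \<Rightarrow> complex" where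
  "coupling k Jc p = (if card (supp p) \<le> k then Jc (supp p) (label_of p) else 0)"

definition local_terms :: "nat \<Rightarrow> ('v::finite set \<Rightarrow> 'v spin_op) \<Rightarrow> 'v set \<Rightarrow> 'v spin_op" where
  "local_terms k h Y = (\<Sum>Z | card Z \<le> k \<and> Z \<subseteq> Y. h Z)"

lemma hamiltonian_eq_local_terms: "hamiltonian k h = local_terms k h UNIV"
  by (simp add: hamiltonian_def local_terms_def)

text \<open>The predicate serves two purposes: \<open>Z \<subseteq> Y\<close> for the local
  Hamiltonians, and equality with a fixed set to apply Parseval to a single term.\<close>

lemma sum_terms_eq_pauli_sum:
  fixes h :: "'v::finite set \<Rightarrow> 'v spin_op"
  assumes expansion: "\<And>Z. card Z \<le> k \<Longrightarrow>
      h Z = (\<Sum>q\<in>pauli_labels Z. cscale_mat (Jc Z q) (pauli_string Z q))"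
  shows "(\<Sum>Z | card Z \<le> k \<and> P Z. h Z) = pauli_sum (\<lambda>p. if P (supp p) then coupling k Jc p else 0)"
proof -
  have "(\<Sum>Z | card Z \<le> k \<and> P Z. h Z)
      = (\<Sum>Z | card Z \<le> k \<and> P Z. \<Sum>q\<in>pauli_labels Z. cscale_mat (Jc Z q) (pauli_op (word_of Z q)))"
    by (intro sum.cong refl) (simp add: expansion pauli_string_eq_pauli_op)
  also have "\<dots> = (\<Sum>p | card (supp p) \<le> k \<and> P (supp p). cscale_mat (Jc (supp p) (label_of p)) (pauli_op p))"
    by (subst sum_pauli_labels) (simp add: word_of_label_of)
  also have "\<dots> = pauli_sum (\<lambda>p. if P (supp p) then coupling k Jc p else 0)"
    unfolding pauli_sum_def
    by (intro sum.mono_neutral_cong_left) (auto simp: coupling_def vec_eq_iff)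
  finally show ?thesis .
qed

lemma hermitian_sum: "(\<And>x. x \<in> I \<Longrightarrow> hermitian_mat (f x)) \<Longrightarrow> hermitian_mat (\<Sum>x\<in>I. f x)"
  by (simp add: hermitian_mat_def vec_eq_iff)

text \<open>Cauchy--Schwarz over the \<open>3^|Z|\<close> words on \<open>Z\<close>; this is where \<open>3 powr (k / 2)\<close> comes from.\<close>

lemma sum_coefficients_le_op_norm:
  fixes h :: "'v::finite set \<Rightarrow> 'v spin_op"
  assumes expansion: "\<And>Z. card Z \<le> k \<Longrightarrow>
      h Z = (\<Sum>q\<in>pauli_labels Z. cscale_mat (Jc Z q) (pauli_string Z q))"
    and Z: "card Z \<le> k"
  shows "(\<Sum>q\<in>pauli_labels Z. cmod (Jc Z q)) \<le> 3 powr (real k / 2) * op_norm (h Z)"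
proof -
  define N where "N = real CARD('v \<Rightarrow> 2)"
  have N: "N > 0" by (simp add: N_def)
  have "h Z = (\<Sum>Z' | card Z' \<le> k \<and> Z' = Z. h Z')" using Z by (simp add: Collect_conv_if cong: conj_cong)
  also have "\<dots> = pauli_sum (\<lambda>p. if supp p = Z then coupling k Jc p else 0)"
    by (rule sum_terms_eq_pauli_sum[OF expansion])
  finally have "(norm (h Z))\<^sup>2 = N * (\<Sum>p\<in>UNIV. (cmod (if supp p = Z then coupling k Jc p else 0))\<^sup>2)"
    by (simp only: norm_pauli_sum N_def)
  also have "(\<Sum>p\<in>UNIV. (cmod (if supp p = Z then coupling k Jc p else 0))\<^sup>2)
      = (\<Sum>p | supp p \<in> {Z}. (cmod (Jc (supp p) (label_of p)))\<^sup>2)"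
    using Z by (intro sum.mono_neutral_cong_right) (auto simp: coupling_def)
  also have "\<dots> = (\<Sum>q\<in>pauli_labels Z. (cmod (Jc Z q))\<^sup>2)"
    by (subst sum_pauli_labels[symmetric]) simp
  finally have eq: "(norm (h Z))\<^sup>2 = N * (\<Sum>q\<in>pauli_labels Z. (cmod (Jc Z q))\<^sup>2)" .
  \<comment> \<open>The dimension factor between the two norms cancels the one in Parseval's
    identity, so the bound is independent of the lattice size.\<close>
  have "(norm (h Z))\<^sup>2 \<le> (sqrt N * op_norm (h Z))\<^sup>2"
    unfolding N_def by (intro power_mono norm_le_op_norm) simp
  then have le: "(\<Sum>q\<in>pauli_labels Z. (cmod (Jc Z q))\<^sup>2) \<le> (op_norm (h Z))\<^sup>2"
    using N by (simp add: eq power_mult_distrib)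
  have "(\<Sum>q\<in>pauli_labels Z. cmod (Jc Z q))\<^sup>2
      \<le> (\<Sum>q\<in>pauli_labels Z. (cmod (Jc Z q))\<^sup>2) * real (card (pauli_labels Z))"
    by (rule sum_squared_le_sum_of_squares)
  also have "\<dots> \<le> (op_norm (h Z))\<^sup>2 * 3 ^ k"
    using Z by (intro mult_mono le) (auto simp: card_pauli_labels intro: power_increasing)
  also have "(3::real) ^ k = (3 powr (real k / 2))\<^sup>2"
    by (simp add: powr_realpow flip: powr_numeral powr_powr) (simp add: powr_powr flip: powr_realpow)
  finally have "(\<Sum>q\<in>pauli_labels Z. cmod (Jc Z q))\<^sup>2 \<le> (3 powr (real k / 2) * op_norm (h Z))\<^sup>2"
    by (simp add: power_mult_distrib mult.commute)
  then show ?thesis by (rule power2_le_imp_le) simp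
qed

lemma pair_mass_coupling:
  "pair_mass (coupling k Jc) x y = (\<Sum>Z | card Z \<le> k \<and> {x, y} \<subseteq> Z. \<Sum>q\<in>pauli_labels Z. cmod (Jc Z q))"
  unfolding sum_pauli_labels pair_mass_def
  by (intro sum.mono_neutral_cong_right) (auto simp: coupling_def split: if_splits)

lemma pair_mass_coupling_le:
  fixes h :: "'v::finite set \<Rightarrow> 'v spin_op"
  assumes expansion: "\<And>Z. card Z \<le> k \<Longrightarrow>
      h Z = (\<Sum>q\<in>pauli_labels Z. cscale_mat (Jc Z q) (pauli_string Z q))"
    and decay: "(\<Sum>Z | card Z \<le> k \<and> {x, y} \<subseteq> Z. op_norm (h Z)) \<le> J0 * w"
  shows "pair_mass (coupling k Jc) x y \<le> J_const k J0 * w"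
proof -
  have "pair_mass (coupling k Jc) x y \<le> (\<Sum>Z | card Z \<le> k \<and> {x, y} \<subseteq> Z. 3 powr (real k / 2) * op_norm (h Z))"
    unfolding pair_mass_coupling using expansion
    by (intro sum_mono sum_coefficients_le_op_norm) auto
  also have "\<dots> = 3 powr (real k / 2) * (\<Sum>Z | card Z \<le> k \<and> {x, y} \<subseteq> Z. op_norm (h Z))"
    by (simp add: sum_distrib_left)
  also have "\<dots> \<le> 3 powr (real k / 2) * (J0 * w)" by (intro mult_left_mono decay) simp
  finally show ?thesis by (simp add: J_const_def)
qed

section \<open>Approximation by local evolution\<close>

lemma local_terms_hermitian:
  assumes "\<And>Z. card Z \<le> k \<Longrightarrow> hermitian_mat (h Z)"
  shows "hermitian_mat (local_terms k h Y)"
  unfolding local_terms_def using assms by (intro hermitian_sum) auto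

lemma local_terms_supported:
  assumes "\<And>Z. card Z \<le> k \<Longrightarrow> supported_on Z (h Z)"
  shows "supported_on Y (local_terms k h Y)"
  unfolding local_terms_def using assms by (intro supported_on_sum) (auto intro: supported_on_mono)

lemma norm_evolve_diff_local_le:
  fixes h :: "'v::finite set \<Rightarrow> 'v spin_op"
  assumes hermitian: "\<And>Z. card Z \<le> k \<Longrightarrow> hermitian_mat (h Z)"
    and expansion: "\<And>Z. card Z \<le> k \<Longrightarrow>
      h Z = (\<Sum>q\<in>pauli_labels Z. cscale_mat (Jc Z q) (pauli_string Z q))"
    and g: "\<And>z. pair_mass (coupling k Jc) z z \<le> g"
    and coupling_J: "\<And>x y. pair_mass (coupling k Jc) x y \<le> J * w x y"
    and w: "\<And>x y. 0 \<le> w x y" "\<And>x y. (\<Sum>z\<in>UNIV. w x z * w z y) \<le> lam * w x y"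
    and J: "0 \<le> J" and gt: "g * real k \<le> gt" "lam * J \<le> gt"
    and dt: "0 \<le> dt" "2 * gt * dt \<le> 1 / 2"
    and B: "supported_on X B" "op_norm B \<le> 1"
  shows "norm (evolve (hamiltonian k h) dt B - evolve (local_terms k h Y) dt B)
    \<le> dt * (8 * (sqrt (real CARD('v \<Rightarrow> 2)) * (J * sqrt (\<Sum>x\<in>X. \<Sum>y\<in>-Y. (w x y)\<^sup>2))))"
proof -
  define b where "b = coupling k Jc"
  define A where "A = cscale_mat \<i> (hamiltonian k h)"
  define A' where "A' = cscale_mat \<i> (local_terms k h Y)"
  \<comment> \<open>The minus sign reflects the backward evolution in Duhamel's formula: evolving by
    \<open>- s\<close> under \<open>A'\<close> is evolving by \<open>s\<close> under
    \<open>- A'\<close>.\<close>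
  define c where "c p = (if supp p \<subseteq> Y then - \<i> * b p else 0)" for p
  define a0 where "a0 p = (if supp p \<subseteq> Y then 0 else \<i> * b p)" for p
  have ps: "local_terms k h Y = pauli_sum (\<lambda>p. if supp p \<subseteq> Y then b p else 0)" for Y
    unfolding local_terms_def b_def by (rule sum_terms_eq_pauli_sum[OF expansion])
  have A: "A = pauli_sum (\<lambda>p. \<i> * b p)"
    by (simp add: A_def hamiltonian_eq_local_terms ps cscale_pauli_sum)
  have A'_eq: "A' = pauli_sum (\<lambda>p. \<i> * (if supp p \<subseteq> Y then b p else 0))"
    by (simp add: A'_def ps cscale_pauli_sum)
  have diff: "A - A' = pauli_sum a0"
    unfolding A A'_eq pauli_sum_diff by (rule arg_cong[of _ _ pauli_sum]) (auto simp: a0_def)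
  have neg: "- A' = pauli_sum c"
    unfolding A'_eq pauli_sum_def sum_negf[symmetric]
    by (intro sum.cong refl) (auto simp: c_def vec_eq_iff)
  have ah: "antihermitian A" "antihermitian A'" "antihermitian (pauli_sum c)"
  proof -
    show 1: "antihermitian A" "antihermitian A'"
      unfolding A_def A'_def hamiltonian_eq_local_terms
      by (intro antihermitian_i_hermitian local_terms_hermitian hermitian; assumption)+
    have "adjoint_mat (- A') = - adjoint_mat A'" by (simp add: vec_eq_iff)
    then show "antihermitian (pauli_sum c)"
      using 1(2) by (simp add: antihermitian_def flip: neg)
  qed
  have c_le: "cmod (c p) \<le> cmod (b p)" and a0_le: "cmod (a0 p) \<le> cmod (b p)" for p
    by (simp_all add: c_def a0_def norm_mult)
  have b_card: "b p \<noteq> 0 \<Longrightarrow> card (supp p) \<le> k" for p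
    by (auto simp: b_def coupling_def split: if_splits)
  show ?thesis
    unfolding evolve_eq_heis A_def[symmetric] A'_def[symmetric]
  proof (rule norm_heis_diff_le[OF ah(1,2) dt(1)])
    fix s assume s: "0 \<le> s" "s \<le> dt"
    have "0 \<le> g" using g[of undefined] pair_mass_nonneg[of "coupling k Jc" undefined undefined] by linarith
    then have "0 \<le> gt" using gt(1) by (meson mult_nonneg_nonneg of_nat_0_le_iff order_trans)
    then have "2 * gt * s \<le> 2 * gt * dt" using s by (intro mult_left_mono) auto
    then have s': "2 * gt * s \<le> 1 / 2" using dt by linarith
    have "heis A' (- s) (A - A') = heis (pauli_sum c) s (pauli_sum a0)"
      by (simp add: diff heis_uminus flip: neg)
    moreover have "norm (commutator (heis (pauli_sum c) s (pauli_sum a0)) B)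
      \<le> 8 * (sqrt (real CARD('v \<Rightarrow> 2)) * (J * sqrt (\<Sum>x\<in>X. \<Sum>y\<in>-Y. (w x y)\<^sup>2)))"
    proof (rule norm_commutator_heis_pauli_sum_le[OF _ _ _ _ _ _ _ w J gt ah(3) s(1) s' B])
      show "supp q \<subseteq> Y" if "c q \<noteq> 0" for q using that by (auto simp: c_def split: if_splits)
      show "card (supp q) \<le> k" if "c q \<noteq> 0" for q
        using that b_card[of q] by (auto simp: c_def split: if_splits)
      show "\<not> supp p \<subseteq> Y" if "a0 p \<noteq> 0" for p using that by (auto simp: a0_def split: if_splits)
      show "card (supp p) \<le> k" if "a0 p \<noteq> 0" for p
        using that b_card[of p] by (auto simp: a0_def split: if_splits)
      show "pair_mass c z z \<le> g" for z
        using pair_mass_mono[of c b z z, OF c_le] g[of z] by (simp add: b_def)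
      show "pair_mass c x y \<le> J * w x y" for x y
        using pair_mass_mono[of c b x y, OF c_le] coupling_J[of x y] by (simp add: b_def)
      show "pair_mass a0 x y \<le> J * w x y" for x y
        using pair_mass_mono[of a0 b x y, OF a0_le] coupling_J[of x y] by (simp add: b_def)
    qed
    ultimately show "norm (commutator (heis A' (- s) (A - A')) B)
      \<le> 8 * (sqrt (real CARD('v \<Rightarrow> 2)) * (J * sqrt (\<Sum>x\<in>X. \<Sum>y\<in>-Y. (w x y)\<^sup>2)))"
      by simp
  qed
qed

text \<open>Makes the crossing bound uniform over the steps: outer radii are at most
  \<open>m * L\<close>, and both factors of the denominator are at least
  \<open>\<alpha> - D\<close>. The powers of \<open>L\<close> then combine to
  \<open>2 * (D - \<alpha>)\<close> under the root.\<close>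

lemma sqrt_sum_crossing_le:
  fixes E :: "('v::finite \<times> 'v) set" and D L m s :: nat and \<alpha> \<gamma> :: real
  assumes graph: "connected_graph E" and D: "D \<ge> 1" and gamma: "\<gamma> \<ge> 1"
    and sphere: "\<And>j r. r \<ge> 1 \<Longrightarrow> real (card (gsphere E j r)) \<le> \<gamma> * real r ^ (D - 1)"
    and alpha: "\<alpha> > real D" and L: "L \<ge> 1" and s: "s < m"
  shows "sqrt (\<Sum>x\<in>gball E i (s * L). \<Sum>y\<in>- gball E i (Suc s * L). ((real (gdist E x y) + 1) powr (- \<alpha>))\<^sup>2)
    \<le> \<gamma> * real m powr ((real D - 1) / 2) * real L powr (real D - \<alpha>) / (\<alpha> - real D)"
proof (rule real_le_lsqrt)
  have D1: "real (D - Suc 0) = real D - 1" using D by (simp add: of_nat_diff)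
  have "(\<Sum>x\<in>gball E i (s * L). \<Sum>y\<in>- gball E i (Suc s * L). ((real (gdist E x y) + 1) powr (- \<alpha>))\<^sup>2)
    \<le> \<gamma>\<^sup>2 * real (s * L + L) ^ (D - 1) * real L powr (1 + real D - 2 * \<alpha>)
        / ((2 * \<alpha> - real D) * (2 * \<alpha> - real D - 1))"
    using sum_crossing_le[OF graph D gamma sphere alpha L, of i "s * L"] by (simp add: add.commute)
  also have "\<dots> \<le> \<gamma>\<^sup>2 * real (m * L) ^ (D - 1) * real L powr (1 + real D - 2 * \<alpha>)
        / ((\<alpha> - real D) * (\<alpha> - real D))"
  proof (intro frac_le mult_mono power_mono)
    have "s * L + L = Suc s * L" by simp
    also have "\<dots> \<le> m * L" using s by (intro mult_le_mono1) simp
    finally show "real (s * L + L) \<le> real (m * L)" by (simp only: of_nat_le_iff)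
  qed (use alpha D gamma in auto)
  also have "\<dots> = (\<gamma> * real m powr ((real D - 1) / 2) * real L powr (real D - \<alpha>) / (\<alpha> - real D))\<^sup>2"
  proof -
    have "real m ^ (D - 1) = (real m powr ((real D - 1) / 2))\<^sup>2"
      using s by (simp add: powr_realpow[symmetric] D1 powr_powr diff_divide_distrib flip: powr_numeral)
    moreover have "real L ^ (D - 1) * real L powr (1 + real D - 2 * \<alpha>) = (real L powr (real D - \<alpha>))\<^sup>2"
      using L by (simp add: powr_realpow[symmetric] D1 powr_powr powr_add[symmetric] flip: powr_numeral)
        (simp add: algebra_simps)
    ultimately show ?thesis
      by (simp add: power_mult_distrib power_divide power2_eq_square mult_ac)
  qed
  finally show "(\<Sum>x\<in>gball E i (s * L). \<Sum>y\<in>- gball E i (Suc s * L). ((real (gdist E x y) + 1) powr (- \<alpha>))\<^sup>2)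
    \<le> (\<gamma> * real m powr ((real D - 1) / 2) * real L powr (real D - \<alpha>) / (\<alpha> - real D))\<^sup>2" .
qed (use alpha gamma in auto)

text \<open>The second summand of \<open>C0_const\<close> dominates: \<open>J \<le> gt\<close>, 8 is
  below 80, and its power of 2 and square root are at least 1. The nonnegative first summand and the
  factor \<open>2 ^ (D - 1)\<close> only enlarge the right side.\<close>

lemma C0_const_ge:
  assumes D: "D \<ge> 1" and gamma: "\<gamma> \<ge> 1" and alpha: "\<alpha> > real D" and J0: "0 \<le> J0"
    and J: "0 \<le> J" "J \<le> gt"
  shows "8 * J * \<gamma> / (\<alpha> - real D) \<le> 2 ^ (D - 1) * C0_const D \<alpha> \<gamma> J0 gt"
proof -
  define P where "P = gt * \<gamma> / (\<alpha> - real D)"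
  have P: "0 \<le> P" using J gamma alpha by (simp add: P_def)
  have root: "1 \<le> sqrt (2 * \<alpha> - 2 * real D + \<gamma>)" using alpha gamma by simp
  have pow: "1 \<le> 2 powr ((3 * \<alpha> - real D) / 2)" using alpha by (intro ge_one_powr_ge_zero) auto
  have "8 * J * \<gamma> / (\<alpha> - real D) \<le> 80 * P"
  proof -
    have "J * \<gamma> / (\<alpha> - real D) \<le> P"
      unfolding P_def using J gamma alpha by (intro divide_right_mono mult_right_mono) auto
    then show ?thesis using P by (simp add: mult.assoc)
  qed
  also have "\<dots> \<le> 80 * P * (2 powr ((3 * \<alpha> - real D) / 2) * sqrt (2 * \<alpha> - 2 * real D + \<gamma>))"
    using P mult_mono[OF pow root] mult_left_mono[of 1 "2 powr ((3 * \<alpha> - real D) / 2) * sqrt (2 * \<alpha> - 2 * real D + \<gamma>)" "80 * P"]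
    by simp
  also have "\<dots> \<le> 2 powr (\<alpha> - real D / 2 + 2) * J0 * \<gamma> / (2 * \<alpha> - real D - 1) + \<dots>"
    using J0 gamma alpha D by (simp add: divide_nonneg_nonneg)
  also have "\<dots> = C0_const D \<alpha> \<gamma> J0 gt"
    by (simp add: C0_const_def P_def mult_ac)
  finally have C0: "8 * J * \<gamma> / (\<alpha> - real D) \<le> C0_const D \<alpha> \<gamma> J0 gt" .
  moreover have "0 \<le> 8 * J * \<gamma> / (\<alpha> - real D)" using J gamma alpha by simp
  ultimately have "1 * C0_const D \<alpha> \<gamma> J0 gt \<le> 2 ^ (D - 1) * C0_const D \<alpha> \<gamma> J0 gt"
    by (intro mult_right_mono) auto
  then show ?thesis using C0 by simp
qed

text \<open>Explains the exponents of the final bound: with \<open>t = m * dt\<close> and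
  \<open>R = l * m\<close>, the powers of \<open>dt\<close> combine to 1 and those of
  \<open>m\<close> to \<open>1 + (d - 1) / 2\<close>.\<close>

lemma step_powers:
  fixes dt \<alpha> d :: real
  assumes "0 < dt" "0 < m" "0 < l"
  shows "dt powr (- \<alpha> + (d + 1) / 2) * (m * dt) powr (\<alpha> - (d - 1) / 2) * (l * m) powr (- \<alpha> + d)
    = m * dt * m powr ((d - 1) / 2) * l powr (d - \<alpha>)"
proof -
  have "dt powr (- \<alpha> + (d + 1) / 2) * (m * dt) powr (\<alpha> - (d - 1) / 2) * (l * m) powr (- \<alpha> + d)
    = (dt powr (- \<alpha> + (d + 1) / 2) * dt powr (\<alpha> - (d - 1) / 2)) *
      (m powr (\<alpha> - (d - 1) / 2) * m powr (- \<alpha> + d)) * l powr (- \<alpha> + d)"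
    using assms by (simp add: powr_mult mult_ac)
  also have "dt powr (- \<alpha> + (d + 1) / 2) * dt powr (\<alpha> - (d - 1) / 2) = dt powr 1"
    by (simp add: field_simps flip: powr_add)
  also have "m powr (\<alpha> - (d - 1) / 2) * m powr (- \<alpha> + d) = m powr (1 + (d - 1) / 2)"
    by (simp add: field_simps flip: powr_add)
  also have "\<dots> = m * m powr ((d - 1) / 2)" using assms by (simp add: powr_add)
  finally show ?thesis using assms by (simp add: add.commute mult_ac)
qed

theorem theorem2:
  fixes E :: "('v::finite \<times> 'v) set"
    and D k R :: nat
    and \<alpha> \<gamma> J0 g lam gt t dt :: real
    and h :: "'v set \<Rightarrow> 'v spin_op"
    and Jc :: "'v set \<Rightarrow> ('v \<Rightarrow> pauli) \<Rightarrow> complex"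
    and i :: 'v
    and W :: "'v spin_op"
  assumes graph: "connected_graph E"
    and D: "D \<ge> 1"
    and gamma: "\<gamma> \<ge> 1"
    and ball: "\<And>j r. r \<ge> 1 \<Longrightarrow> real (card (gball E j r)) \<le> \<gamma> * real r ^ D"
    and sphere: "\<And>j r. r \<ge> 1 \<Longrightarrow> real (card (gsphere E j r)) \<le> \<gamma> * real r ^ (D - 1)"
    and hermitian: "\<And>Z. card Z \<le> k \<Longrightarrow> hermitian_mat (h Z)"
    and support: "\<And>Z. card Z \<le> k \<Longrightarrow> supported_on Z (h Z)"
    and expansion: "\<And>Z. card Z \<le> k \<Longrightarrow>
      h Z = (\<Sum>q\<in>pauli_labels Z. cscale_mat (Jc Z q) (pauli_string Z q))"
    and alpha: "\<alpha> > real D"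
    and decay: "\<And>j j'. (\<Sum>Z | card Z \<le> k \<and> {j, j'} \<subseteq> Z. op_norm (h Z))
      \<le> J0 * (real (gdist E j j') + 1) powr (- \<alpha>)"
    and g: "\<And>j. (\<Sum>(Z, q)\<in>(SIGMA Z:{Z. card Z \<le> k \<and> j \<in> Z}. pauli_labels Z). cmod (Jc Z q)) \<le> g"
    and lam: "\<And>j j'. (\<Sum>j0\<in>UNIV. (real (gdist E j j0) + 1) powr (- \<alpha>)
        * (real (gdist E j0 j') + 1) powr (- \<alpha>))
      \<le> lam * (real (gdist E j j') + 1) powr (- \<alpha>)"
    and gt: "gt = g_tilde k g lam J0"
    and t: "t > 0"
    and dt_pos: "dt > 0"
    and dt_less: "gt = 0 \<or> dt < 1 / (2 * exp 1 * gt)"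
    and steps: "t / dt \<in> \<nat>"
    and R_pos: "R > 0"
    and R_mult: "\<exists>l::nat. real R = real l * (t / dt)"
    and W_supp: "supported_on {i} W"
    and W_norm: "op_norm W = 1"
  shows "\<exists>Wt. supported_on (gball E i R) Wt \<and>
    frob_norm (evolve (hamiltonian k h) t W - Wt)
      \<le> 2 ^ (D - 1) * C0_const D \<alpha> \<gamma> J0 gt
         * dt powr (- \<alpha> + (real D + 1) / 2)
         * t powr (\<alpha> - (real D - 1) / 2)
         * real R powr (- \<alpha> + real D)"
proof -
  define J where "J = J_const k J0"
  define w where "w x y = (real (gdist E x y) + 1) powr (- \<alpha>)" for x y
  define H where "H = hamiltonian k h"
  have w: "0 \<le> w x y" for x y by (simp add: w_def)
  have w_self: "w x x = 1" for x by (simp add: w_def)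
  have conv: "(\<Sum>z\<in>UNIV. w x z * w z y) \<le> lam * w x y" for x y
    using lam by (simp add: w_def)
  have J0: "0 \<le> J0"
  proof -
    have "0 \<le> (\<Sum>Z | card Z \<le> k \<and> {i, i} \<subseteq> Z. op_norm (h Z))" by (intro sum_nonneg) simp
    then show ?thesis using decay[of i i] by simp
  qed
  then have J: "0 \<le> J" by (simp add: J_def J_const_def)
  \<comment> \<open>The single term \<open>z = i\<close> of the convolution forces
    \<open>lam\<close> to be at least 1, whence \<open>J \<le> lam * J \<le> gt\<close>.\<close>
  have "w i i * w i i \<le> (\<Sum>z\<in>UNIV. w i z * w z i)"
    by (rule member_le_sum) (auto simp: w)
  then have lam1: "1 \<le> lam" using conv[of i i] by (simp add: w_self)
  have gt_ge: "g * real k \<le> gt" "lam * J \<le> gt" by (simp_all add: gt g_tilde_def J_def)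
  have J_le: "J \<le> gt" using mult_right_mono[OF lam1 J] gt_ge(2) by simp
  \<comment> \<open>The bound \<open>dt < 1 / (2 * exp 1 * gt)\<close> gives
    \<open>2 * gt * dt < 1 / exp 1\<close>, which is below one half.\<close>
  have dt_small: "2 * gt * dt \<le> 1 / 2"
  proof (cases "gt = 0")
    case False
    then have pos: "0 < gt" using J J_le by simp
    have "2 * gt * dt < 2 * gt * (1 / (2 * exp 1 * gt))"
      using dt_less False pos by (intro mult_strict_left_mono) auto
    also have "\<dots> = 1 / exp 1" using pos by simp
    also have "\<dots> \<le> 1 / (2 :: real)"
      using exp_ge_add_one_self[of 1] by (intro divide_left_mono) auto
    finally show ?thesis by simp
  qed simp
  have mass_g: "pair_mass (coupling k Jc) z z \<le> g" for z
  proof -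
    have "pair_mass (coupling k Jc) z z
        = (\<Sum>(Z, q)\<in>(SIGMA Z:{Z. card Z \<le> k \<and> z \<in> Z}. pauli_labels Z). cmod (Jc Z q))"
      unfolding pair_mass_coupling by (simp add: sum.Sigma)
    then show ?thesis using g[of z] by simp
  qed
  have mass_J: "pair_mass (coupling k Jc) x y \<le> J * w x y" for x y
    unfolding J_def by (rule pair_mass_coupling_le[OF expansion]) (use decay[of x y] in \<open>simp_all add: w_def\<close>)
  obtain m where m: "t / dt = real m" using steps by (auto simp: Nats_def)
  have t_eq: "t = real m * dt" using m dt_pos by (simp add: field_simps)
  then have m_pos: "0 < m" using t dt_pos by (cases m) auto
  obtain l where "real R = real l * real m" using R_mult m by auto
  then have R_eq: "R = m * l" by (simp add: mult.commute flip: of_nat_mult)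
  then have l: "1 \<le> l" using R_pos by (cases l) auto
  \<comment> \<open>The ball is enlarged by \<open>l\<close> before each step, so \<open>W\<close>
    starts on the ball of radius 0 and \<open>Os m\<close> lives on the one of radius
    \<open>m * l = R\<close>.\<close>
  define Os where "Os = rec_nat W (\<lambda>s B. evolve (local_terms k h (gball E i (Suc s * l))) dt B)"
  have Os_0: "Os 0 = W" and Os_Suc: "Os (Suc s) = evolve (local_terms k h (gball E i (Suc s * l))) dt (Os s)" for s
    by (simp_all add: Os_def)
  have Os_supp: "supported_on (gball E i (s * l)) (Os s)" for s
  proof (induction s)
    case 0
    have "gball E i 0 = {i}" by (auto simp: gball_def gdist_eq_0_iff[OF graph])
    then show ?case using W_supp by (simp add: Os_0)
  next
    case (Suc s)
    have "supported_on (gball E i (Suc s * l)) (Os s)"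
      using Suc by (rule supported_on_mono) (auto simp: gball_def)
    then show ?case
      unfolding Os_Suc evolve_eq_heis
      by (intro supported_on_heis supported_on_cscale local_terms_supported support)
  qed
  have Os_norm: "op_norm (Os s) \<le> 1" for s
  proof (induction s)
    case (Suc s)
    have "op_norm (Os (Suc s)) \<le> op_norm (Os s)"
      unfolding Os_Suc evolve_eq_heis
      by (intro op_norm_heis_le antihermitian_i_hermitian local_terms_hermitian hermitian)
    then show ?case using Suc by simp
  qed (simp add: Os_0 W_norm)
  define N where "N = sqrt (real CARD('v \<Rightarrow> 2))"
  have N: "0 < N" by (simp add: N_def)
  define Q where "Q = \<gamma> * real m powr ((real D - 1) / 2) * real l powr (real D - \<alpha>) / (\<alpha> - real D)"
  have step: "norm (evolve H dt (Os s) - Os (Suc s)) \<le> dt * (8 * (N * (J * Q)))" if "s < m" for s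
  proof -
    have "norm (evolve H dt (Os s) - Os (Suc s)) \<le> dt * (8 * (N * (J *
        sqrt (\<Sum>x\<in>gball E i (s * l). \<Sum>y\<in>- gball E i (Suc s * l). (w x y)\<^sup>2))))"
      unfolding H_def Os_Suc N_def
      using norm_evolve_diff_local_le[OF hermitian expansion mass_g mass_J w conv J gt_ge _ dt_small Os_supp Os_norm] dt_pos
      by simp
    also have "\<dots> \<le> dt * (8 * (N * (J * Q)))"
      unfolding w_def Q_def
      using dt_pos N J by (intro mult_left_mono sqrt_sum_crossing_le graph D gamma sphere alpha l that) auto
    finally show ?thesis .
  qed
  have total: "norm (evolve H (real s * dt) W - Os s) \<le> real s * (dt * (8 * (N * (J * Q))))" if "s \<le> m" for s
    using that
  proof (induction s)
    case 0
    then show ?case by (simp add: Os_0 evolve_eq_heis)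
  next
    case (Suc s)
    let ?A = "cscale_mat \<i> H"
    have ah: "antihermitian ?A"
      unfolding H_def hamiltonian_eq_local_terms
      by (intro antihermitian_i_hermitian local_terms_hermitian hermitian)
    \<comment> \<open>The error made so far is carried along by the exact evolution, an isometry, so
      the errors of the steps simply add.\<close>
    have "evolve H (real (Suc s) * dt) W - Os (Suc s)
        = heis ?A dt (heis ?A (real s * dt) W - Os s) + (evolve H dt (Os s) - Os (Suc s))"
      by (simp add: evolve_eq_heis heis_diff distrib_right flip: heis_add)
    also have "norm \<dots> \<le> norm (heis ?A (real s * dt) W - Os s) + norm (evolve H dt (Os s) - Os (Suc s))"
      by (rule order_trans[OF norm_triangle_ineq]) (simp add: norm_heis[OF ah])
    also have "\<dots> \<le> real s * (dt * (8 * (N * (J * Q)))) + dt * (8 * (N * (J * Q)))"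
      using Suc step[of s] by (intro add_mono) (simp_all add: evolve_eq_heis)
    finally show ?case by (simp add: algebra_simps)
  qed
  have "frob_norm (evolve H t W - Os m) = norm (evolve H (real m * dt) W - Os m) / N"
    by (simp add: frob_norm_eq N_def t_eq)
  also have "\<dots> \<le> real m * (dt * (8 * (N * (J * Q)))) / N"
    using total[of m] N by (intro divide_right_mono) auto
  \<comment> \<open>The dimension factor \<open>N\<close> cancels because \<open>frob_norm\<close>
    is normalised.\<close>
  also have "\<dots> = (8 * J * \<gamma> / (\<alpha> - real D)) *
      (real m * dt * real m powr ((real D - 1) / 2) * real l powr (real D - \<alpha>))"
    using N by (simp add: Q_def mult_ac)
  also have "\<dots> \<le> (2 ^ (D - 1) * C0_const D \<alpha> \<gamma> J0 gt) *
      (real m * dt * real m powr ((real D - 1) / 2) * real l powr (real D - \<alpha>))"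
    using dt_pos by (intro mult_right_mono C0_const_ge D gamma alpha J0 J J_le) auto
  also have "real m * dt * real m powr ((real D - 1) / 2) * real l powr (real D - \<alpha>)
      = dt powr (- \<alpha> + (real D + 1) / 2) * t powr (\<alpha> - (real D - 1) / 2) * real R powr (- \<alpha> + real D)"
    unfolding t_eq R_eq using step_powers[of dt "real m" "real l" \<alpha> "real D"] dt_pos m_pos l
    by (simp add: mult.commute[of "real m" "real l"])
  finally have "frob_norm (evolve H t W - Os m) \<le> 2 ^ (D - 1) * C0_const D \<alpha> \<gamma> J0 gt
         * dt powr (- \<alpha> + (real D + 1) / 2) * t powr (\<alpha> - (real D - 1) / 2) * real R powr (- \<alpha> + real D)"
    by (simp add: mult.assoc)
  moreover have "supported_on (gball E i R) (Os m)" using Os_supp[of m] by (simp add: R_eq)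
  ultimately show ?thesis unfolding H_def by blast
qed

end
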